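(* Consider the distributed online problem and the distributed online primal--dual composite mirror descent algorithm described in the context. Suppose that: (1) $\mathbb{X}\subseteq\mathbb{R}^p$ is closed and convex, and for all $i\in[n]$, $t\in\mathbb{N}_+$ the functions $r_t$, $f_{i,t}$, $g_{i,t}$ are convex ($g_{i,t}$ componentwise). (2) There is a constant $F>0$ with $|l_{i,t}(x)-l_{i,t}(y)|\le F$ for all $i\in[n]$, $t\in\mathbb{N}_+$, $x,y\in\mathbb{X}$. (3) For all $i\in[n]$, $t\in\mathbb{N}_+$, $x\in\mathbb{X}$ the subgradients $\nabla r_t(x),\nabla f_{i,t}(x),\nabla g_{i,t}(x)$ exist, and there are constants $G_1,G_2>0$ with $\|\nabla l_{i,t}(x)\|\le G_1$ and $\|\nabla g_{i,t}(x)\|\le G_2$ for all such $i,t,x$. (4) For every $t\in\mathbb{N}_+$: (a) there is a constant $w\in(0,1)$ (independent of $t$) such that $[W_t]_{ij}\ge w$ whenever $[W_t]_{ij}>0$; (b) $W_t$ is doubly stochastic; (c) there is an integer $B>0$ (independent of $t$) such that the directed graph $(\mathcal{V},\cup_{l=0}^{B-1}\mathcal{E}_{t+l})$ is strongly connected. (5) For every $x\in\mathbb{X}$ the function $\mathcal{D}_\psi(x,\cdot):\mathbb{X}\to\mathbb{R}$ is convex. (6) There is a constant $K>0$ with $\mathcal{D}_\psi(x,y)\le K$ for all $x,y\in\mathbb{X}$. (7) (Slater's condition) There exist a point $x_s\in\mathbb{X}$ and a constant $\epsilon_s>0$ such that $g_t(x_s)\le-\epsilon_s\mathbf{1}_m$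 for all $t\in\mathbb{N}_+$. Let $\{x_{i,t}\}$, $i\in[n]$, be the sequences generated by the algorithm with $$\alpha_t=\frac{1}{t^{c}},\qquad \gamma_t=\frac{\gamma_0}{\alpha_t},\qquad \forall t\in\mathbb{N}_+,$$ where $c\in(0,1)$ and $\gamma_0\in(0,\sigma/(4G_2^2)]$ are constants. Then, for any $T\in\mathbb{N}_+$, $$\mathrm{Net\text{-}Reg}(T)=\mathcal{O}(T^{\max\{c,1-c\}}),\qquad \frac{1}{n}\sum_{i=1}^n\sum_{t=1}^T\|[g_{t}(x_{i,t})]_+\|=\mathcal{O}(T^{1-c}).$$
   Context: Notation. $[n]=\{1,\dots,n\}$; $\|\cdot\|$ is the Euclidean norm for vectors and the induced 2-norm for matrices; $[x]_+$ is the componentwise positive part (projection onto the nonnegative orthant); vector inequalities are componentwise; $\mathbf{1}_m$ and $\mathbf{0}_m$ are the all-ones and zero vectors of $\mathbb{R}^m$; $\nabla f(x)$ denotes a (sub)gradient of $f$ at $x$. For $g_{i,t}:\mathbb{R}^p\to\mathbb{R}^{m_i}$, $\nabla g_{i,t}(x)\in\mathbb{R}^{m_i\times p}$ is the matrix whose rows are subgradients of the components, so $g_{i,t}(y)\ge g_{i,t}(x)+\nabla g_{i,t}(x)(y-x)$. Bounds on subgradients hold for all subgradients, and $\nabla l_{i,t}(x)=\nabla f_{i,t}(x)+\nabla r_t(x)$. Problem. There are $n$ agents and a known set $\mathbb{X}\subseteq\mathbb{R}^p$. For each $i\in[n]$ and round $t\in\mathbb{N}_+$ there are a local loss $l_{i,t}=f_{i,t}+r_t:\mathbb{R}^p\to\mathbb{R}$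 ($r_t$ common to all agents) and a local constraint function $g_{i,t}:\mathbb{R}^p\to\mathbb{R}^{m_i}$; these may vary arbitrarily with $t$. Set $l_t(x)=\frac1n\sum_{i=1}^n l_{i,t}(x)$, $g_t(x)=\mathrm{col}(g_{1,t}(x),\dots,g_{n,t}(x))\in\mathbb{R}^m$ (stacked column vector), $m=\sum_i m_i$, and $$\mathcal{X}_T=\{x\in\mathbb{X}: g_t(x)\le \mathbf{0}_m,\ \forall t\in[T]\},$$ which is assumed nonempty for every $T$. Network regret is $$\mathrm{Net\text{-}Reg}(T)=\frac1n\sum_{i=1}^n\Big(\sum_{t=1}^T l_t(x_{i,t})-\min_{x\in\mathcal{X}_T}\sum_{t=1}^T l_t(x)\Big),$$ and network cumulative constraint violation is $\frac1n\sum_{i=1}^n\sum_{t=1}^T\|[g_t(x_{i,t})]_+\|$. Communication. At round $t$ the directed graph is $\mathcal{G}_t=(\mathcal{V},\mathcal{E}_t)$, $\mathcal{V}=[n]$, with mixing matrix $W_t\in\mathbb{R}^{n\times n}$ satisfying $[W_t]_{ij}>0$ if $(j,i)\in\mathcal{E}_t$ or $i=j$, and $[W_t]_{ij}=0$ otherwise. Bregman divergence. $\psi:\mathbb{R}^p\to\mathbb{R}$ is differentiable and strongly convex on $\mathbb{X}$ with parameter $\sigma>0$, i.e. $\psi(x)\ge\psi(y)+\langle\nabla\psi(y),x-y\rangle+\frac{\sigma}{2}\|x-y\|^2$ for $x,y\in\mathbb{X}$; $\mathcal{D}_\psi(x,y)=\psi(x)-\psi(y)-\langle\nabla\psi(y),x-y\rangle$.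 Algorithm. Input: a nonincreasing sequence $\{\alpha_t>0\}$ and a nondecreasing sequence $\{\gamma_t>0\}$. Initialize any $z_{i,1}\in\mathbb{X}$, $i\in[n]$. For $t=1,2,\dots$ and each $i\in[n]$: $$x_{i,t}=\sum_{j=1}^n[W_t]_{ij}z_{j,t},\qquad q_{i,t+1}=\gamma_t[g_{i,t}(x_{i,t})]_+,\qquad \omega_{i,t+1}=\nabla f_{i,t}(x_{i,t})+(\nabla g_{i,t}(x_{i,t}))^\top q_{i,t+1},$$ $$z_{i,t+1}=\arg\min_{x\in\mathbb{X}}\{\alpha_t\langle x,\omega_{i,t+1}\rangle+\alpha_t r_t(x)+\mathcal{D}_\psi(x,x_{i,t})\}.$$ Order notation. A quantity indexed by $T$ is $\mathcal{O}(b_T)$ if it is at most $C\,b_T$ for all $T\in\mathbb{N}_+$, with a constant $C>0$ independent of $T$ (depending only on the problem constants, the algorithm constants and the initial points). *)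

theory Defs
  imports "HOL-Analysis.Analysis"
begin

text \<open>
  Conventions. Agents are the elements of a finite type \<open>'n\<close>, points live in \<open>real ^ 'p\<close>, and rounds
  are natural numbers \<open>t \<ge> 1\<close> (values at \<open>t = 0\<close> are never used). The output dimension \<open>m i\<close> of the
  constraint function of agent \<open>i\<close> depends on \<open>i\<close>, so a vector of dimension \<open>d\<close> in constraint space
  is a function on \<open>nat\<close> of which only the components \<open>k < d\<close> count, and a matrix with \<open>d\<close> rows is
  given by its rows \<open>A k :: real ^ 'p\<close>, \<open>k < d\<close>. The Euclidean norm of such a vector is
  \<open>L2_set v {..<d}\<close>.
\<close>

definition subdiff :: "('a::real_inner \<Rightarrow> real) \<Rightarrow> 'a \<Rightarrow> 'a set" where
  "subdiff h x = {v. \<forall>y. h y \<ge> h x + v \<bullet> (y - x)}"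

definition subgrad_matrices :: "nat \<Rightarrow> ('a::real_inner \<Rightarrow> nat \<Rightarrow> real) \<Rightarrow> 'a \<Rightarrow> (nat \<Rightarrow> 'a) set" where
  "subgrad_matrices d h x = {A. \<forall>k<d. A k \<in> subdiff (\<lambda>y. h y k) x}"

text \<open>Induced 2-norm of the matrix with rows \<open>A 0, \<dots>, A (d - 1)\<close>; same shape as \<^const>\<open>onorm\<close>.\<close>

definition matrix_norm2 :: "nat \<Rightarrow> (nat \<Rightarrow> 'a::real_inner) \<Rightarrow> real" where
  "matrix_norm2 d A = (SUP v. L2_set (\<lambda>k. A k \<bullet> v) {..<d} / norm v)"

definition grad :: "('a::real_inner \<Rightarrow> real) \<Rightarrow> 'a \<Rightarrow> 'a" where
  "grad h x = (THE D. GDERIV h x :> D)"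

lemma grad_eqI:
  assumes "GDERIV h x :> D"
  shows "grad h x = D"
  unfolding grad_def
proof (rule the_equality)
  fix D' assume "GDERIV h x :> D'"
  with assms have "(\<lambda>v. v \<bullet> D') = (\<lambda>v. v \<bullet> D)"
    unfolding gderiv_def by (rule has_derivative_unique[rotated])
  then have "v \<bullet> D' = v \<bullet> D" for v by metis
  then show "D' = D" by (metis inner_commute vector_eq_rdot)
qed (fact assms)

definition bregman :: "('a::real_inner \<Rightarrow> real) \<Rightarrow> 'a \<Rightarrow> 'a \<Rightarrow> real" where
  "bregman \<psi> x y = \<psi> x - \<psi> y - grad \<psi> y \<bullet> (x - y)"

definition strongly_convex_on :: "'a::real_inner set \<Rightarrow> real \<Rightarrow> ('a \<Rightarrow> real) \<Rightarrow> bool" where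
  "strongly_convex_on X \<sigma> \<psi> \<longleftrightarrow>
     (\<forall>x\<in>X. \<forall>y\<in>X. \<psi> x \<ge> \<psi> y + grad \<psi> y \<bullet> (x - y) + \<sigma> / 2 * (norm (x - y))\<^sup>2)"

text \<open>An edge \<open>(j, i)\<close> means that agent \<open>i\<close> receives from agent \<open>j\<close>.\<close>

definition mixing_matrix :: "('n \<times> 'n) set \<Rightarrow> real ^ 'n ^ 'n \<Rightarrow> bool" where
  "mixing_matrix E W \<longleftrightarrow>
     (\<forall>i j. if (j, i) \<in> E \<or> i = j then W $ i $ j > 0 else W $ i $ j = 0)"

definition doubly_stochastic :: "real ^ 'n ^ 'n \<Rightarrow> bool" where
  "doubly_stochastic W \<longleftrightarrow>
     (\<forall>i j. W $ i $ j \<ge> 0) \<and> (\<forall>i. (\<Sum>j\<in>UNIV. W $ i $ j) = 1) \<and> (\<forall>j. (\<Sum>i\<in>UNIV. W $ i $ j) = 1)"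

definition strongly_connected :: "('n \<times> 'n) set \<Rightarrow> bool" where
  "strongly_connected E \<longleftrightarrow> (\<forall>i j. (i, j) \<in> E\<^sup>*)"

definition local_loss ::
  "('n \<Rightarrow> nat \<Rightarrow> 'a \<Rightarrow> real) \<Rightarrow> (nat \<Rightarrow> 'a \<Rightarrow> real) \<Rightarrow> 'n \<Rightarrow> nat \<Rightarrow> 'a \<Rightarrow> real" where
  "local_loss f r i t x = f i t x + r t x"

definition global_loss ::
  "('n::finite \<Rightarrow> nat \<Rightarrow> 'a \<Rightarrow> real) \<Rightarrow> (nat \<Rightarrow> 'a \<Rightarrow> real) \<Rightarrow> nat \<Rightarrow> 'a \<Rightarrow> real" where
  "global_loss f r t x = (1 / real CARD('n)) * (\<Sum>i\<in>UNIV. local_loss f r i t x)"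

definition feasible_set ::
  "'a set \<Rightarrow> ('n \<Rightarrow> nat) \<Rightarrow> ('n \<Rightarrow> nat \<Rightarrow> 'a \<Rightarrow> nat \<Rightarrow> real) \<Rightarrow> nat \<Rightarrow> 'a set" where
  "feasible_set X m g T = {x \<in> X. \<forall>t\<in>{1..T}. \<forall>i. \<forall>k<m i. g i t x k \<le> 0}"

text \<open>
  The norm \<open>\<parallel>[g\<^sub>t(x)]\<^sub>+\<parallel>\<close> of the stacked vector; its components are indexed by the pairs
  \<open>(i, k)\<close> with \<open>k < m i\<close>.
\<close>

definition violation ::
  "('n::finite \<Rightarrow> nat) \<Rightarrow> ('n \<Rightarrow> nat \<Rightarrow> 'a \<Rightarrow> nat \<Rightarrow> real) \<Rightarrow> nat \<Rightarrow> 'a \<Rightarrow> real" where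
  "violation m g t x = L2_set (\<lambda>(i, k). max 0 (g i t x k)) (SIGMA i:UNIV. {..<m i})"

text \<open>
  For the problems considered here the infimum below is attained: strong convexity and a bound on the Bregman
  divergence make \<open>X\<close> bounded, hence the feasible set compact, and finite convex functions on
  \<open>real ^ 'p\<close> are continuous.
\<close>

definition net_regret ::
  "'a set \<Rightarrow> ('n::finite \<Rightarrow> nat) \<Rightarrow> ('n \<Rightarrow> nat \<Rightarrow> 'a \<Rightarrow> real) \<Rightarrow> (nat \<Rightarrow> 'a \<Rightarrow> real) \<Rightarrow>
   ('n \<Rightarrow> nat \<Rightarrow> 'a \<Rightarrow> nat \<Rightarrow> real) \<Rightarrow> ('n \<Rightarrow> nat \<Rightarrow> 'a) \<Rightarrow> nat \<Rightarrow> real" where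
  "net_regret X m f r g x T =
     (1 / real CARD('n)) * (\<Sum>i\<in>UNIV. (\<Sum>t=1..T. global_loss f r t (x i t))
        - (INF y\<in>feasible_set X m g T. \<Sum>t=1..T. global_loss f r t y))"

definition net_violation ::
  "('n::finite \<Rightarrow> nat) \<Rightarrow> ('n \<Rightarrow> nat \<Rightarrow> 'a \<Rightarrow> nat \<Rightarrow> real) \<Rightarrow> ('n \<Rightarrow> nat \<Rightarrow> 'a) \<Rightarrow> nat \<Rightarrow> real" where
  "net_violation m g x T =
     (1 / real CARD('n)) * (\<Sum>i\<in>UNIV. \<Sum>t=1..T. violation m g t (x i t))"

text \<open>
  \<open>x\<close> and \<open>z\<close> are sequences produced by the algorithm, for some choice of the subgradients
  \<open>u i t\<close> of \<open>f i t\<close> and of the subgradient matrices \<open>A i t\<close> of \<open>g i t\<close> at \<open>x i t\<close>.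
\<close>

definition generated_by_algorithm ::
  "'a::real_inner set \<Rightarrow> ('a \<Rightarrow> real) \<Rightarrow> (nat \<Rightarrow> real ^ 'n ^ 'n) \<Rightarrow> ('n::finite \<Rightarrow> nat) \<Rightarrow>
   ('n \<Rightarrow> nat \<Rightarrow> 'a \<Rightarrow> real) \<Rightarrow> (nat \<Rightarrow> 'a \<Rightarrow> real) \<Rightarrow> ('n \<Rightarrow> nat \<Rightarrow> 'a \<Rightarrow> nat \<Rightarrow> real) \<Rightarrow>
   (nat \<Rightarrow> real) \<Rightarrow> (nat \<Rightarrow> real) \<Rightarrow> ('n \<Rightarrow> nat \<Rightarrow> 'a) \<Rightarrow> ('n \<Rightarrow> nat \<Rightarrow> 'a) \<Rightarrow> bool" where
  "generated_by_algorithm X \<psi> W m f r g \<alpha> \<gamma> z x \<longleftrightarrow>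
     (\<forall>i. z i 1 \<in> X) \<and>
     (\<exists>u A q \<omega>. \<forall>t\<ge>1. \<forall>i.
        x i t = (\<Sum>j\<in>UNIV. W t $ i $ j *\<^sub>R z j t) \<and>
        u i t \<in> subdiff (f i t) (x i t) \<and>
        A i t \<in> subgrad_matrices (m i) (g i t) (x i t) \<and>
        (\<forall>k<m i. q i (t + 1) k = \<gamma> t * max 0 (g i t (x i t) k)) \<and>
        \<omega> i (t + 1) = u i t + (\<Sum>k<m i. q i (t + 1) k *\<^sub>R A i t k) \<and>
        is_arg_min (\<lambda>y. \<alpha> t * (y \<bullet> \<omega> i (t + 1)) + \<alpha> t * r t y + bregman \<psi> y (x i t))
          (\<lambda>y. y \<in> X) (z i (t + 1)))"

end

theory Submission
  imports Defs
begin

text \<open>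
  For a single agent, mirror descent with the penalty \<open>\<gamma>\<^sub>t \<parallel>[g]\<^sub>+\<parallel>\<^sup>2\<close> gives an energy inequality in which
  the step-size condition on \<open>\<gamma>\<^sub>0\<close> absorbs the coupling of constraint value and movement; double
  stochasticity and convexity of the Bregman divergence in its second argument make its sum over the
  agents telescope. Comparing with Slater's point, where \<open>-\<langle>[g]\<^sub>+, g(x\<^sub>s)\<rangle> \<ge> \<epsilon>\<^sub>s \<parallel>[g]\<^sub>+\<parallel>\<close> and \<open>\<alpha>\<^sub>t \<gamma>\<^sub>t = \<gamma>\<^sub>0\<close>
  is constant, bounds the sum of the local violations by \<open>O(T\<^bsup>1-c\<^esup>)\<close>. Comparing with the current iterate
  bounds each movement \<open>\<parallel>z\<^sub>i\<^sub>,\<^sub>t\<^sub>+\<^sub>1 - x\<^sub>i\<^sub>,\<^sub>t\<parallel>\<close> linearly by \<open>\<alpha>\<^sub>t\<close> and the local violation, so the movements, and by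
  the contraction of the mixing also the consensus errors, sum up to \<open>O(T\<^bsup>1-c\<^esup>)\<close>. The regret then
  follows by dividing the energy inequality for a feasible point by \<open>\<alpha>\<^sub>t\<close> and summing by parts.
\<close>

section \<open>The mirror descent step\<close>

text \<open>The derivative is a linear functional, represented by the vector
  \<open>adjoint h' 1\<close>; so the definite description in \<open>grad\<close> denotes an actual
  gradient.\<close>

lemma GDERIV_grad:
  fixes h :: "'a::euclidean_space \<Rightarrow> real"
  assumes "h differentiable (at x)"
  shows "GDERIV h x :> grad h x"
proof -
  obtain h' where h': "(h has_derivative h') (at x)"
    using assms by (auto simp: differentiable_def)
  then have "linear h'"
    by (rule has_derivative_linear)
  then have "h' = (\<lambda>v. v \<bullet> adjoint h' 1)"
    by (simp add: adjoint_works)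
  with h' have "GDERIV h x :> adjoint h' 1"
    unfolding gderiv_def by simp
  then show ?thesis
    by (simp add: grad_eqI)
qed

lemma bregman_self [simp]: "bregman \<psi> x x = 0"
  by (simp add: bregman_def)

lemma bregman_three_point:
  "bregman \<psi> y x - bregman \<psi> y z - bregman \<psi> z x = (grad \<psi> z - grad \<psi> x) \<bullet> (y - z)"
  by (simp add: bregman_def algebra_simps)

lemma strongly_convex_on_bregman_ge:
  "strongly_convex_on X \<sigma> \<psi> \<Longrightarrow> x \<in> X \<Longrightarrow> y \<in> X \<Longrightarrow> \<sigma> / 2 * (norm (x - y))\<^sup>2 \<le> bregman \<psi> x y"
  unfolding strongly_convex_on_def bregman_def by fastforce

text \<open>First-order optimality along the segment from \<open>z\<close> to \<open>y\<close>: the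
  minimizer is compared with \<open>z + s *\<^sub>R (y - z)\<close>, the inequality is divided by
  \<open>s\<close>, and \<open>s\<close> tends to 0 from the right. Convexity of
  \<open>\<phi>\<close> handles its increment without any derivative; the three-point identity then
  rewrites the gradients of \<open>\<psi>\<close> as Bregman terms.\<close>

lemma mirror_descent_step:
  fixes \<psi> :: "'a::euclidean_space \<Rightarrow> real"
  assumes X: "convex X" and \<phi>: "convex_on X \<phi>"
    and diff: "\<psi> differentiable (at z)"
    and min: "is_arg_min (\<lambda>y. \<phi> y + bregman \<psi> y x) (\<lambda>y. y \<in> X) z"
    and y: "y \<in> X"
  shows "\<phi> z - \<phi> y \<le> bregman \<psi> y x - bregman \<psi> y z - bregman \<psi> z x"
proof -
  have z: "z \<in> X" and le: "\<And>v. v \<in> X \<Longrightarrow> \<phi> z + bregman \<psi> z x \<le> \<phi> v + bregman \<psi> v x"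
    using min by (auto simp: is_arg_min_linorder)
  define p where "p s = z + s *\<^sub>R (y - z)" for s :: real
  have "(\<psi> has_derivative (\<lambda>v. v \<bullet> grad \<psi> z)) (at (p 0))"
    using GDERIV_grad[OF diff] by (simp add: p_def gderiv_def)
  moreover have "(p has_derivative (\<lambda>s. s *\<^sub>R (y - z))) (at 0)"
    unfolding p_def by (auto intro!: derivative_eq_intros)
  ultimately have "((\<lambda>s. \<psi> (p s)) has_derivative (\<lambda>s. (s *\<^sub>R (y - z)) \<bullet> grad \<psi> z)) (at 0)"
    using has_derivative_compose by blast
  then have "((\<lambda>s. \<psi> (p s)) has_real_derivative (y - z) \<bullet> grad \<psi> z) (at 0)"
    by (simp add: has_field_derivative_def mult_commute_abs)
  then have "((\<lambda>s. (\<psi> (p s) - \<psi> z) / s) \<longlongrightarrow> (y - z) \<bullet> grad \<psi> z) (at_right 0)"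
    by (auto simp: DERIV_def p_def intro: filterlim_mono[OF _ order_refl at_within_le_at])
  moreover have "\<forall>\<^sub>F s in at_right (0::real). \<phi> z - \<phi> y + grad \<psi> x \<bullet> (y - z) \<le> (\<psi> (p s) - \<psi> z) / s"
    unfolding eventually_at_right_field
  proof (intro exI[of _ 1] conjI allI impI)
    fix s :: real
    assume s: "0 < s" "s < 1"
    have p: "p s = (1 - s) *\<^sub>R z + s *\<^sub>R y"
      by (simp add: p_def algebra_simps)
    then have "p s \<in> X"
      using convexD[OF X z y, of "1 - s" s] s by simp
    from le[OF this] have "\<phi> z + bregman \<psi> z x \<le> \<phi> (p s) + bregman \<psi> (p s) x" .
    moreover have "\<phi> (p s) \<le> (1 - s) * \<phi> z + s * \<phi> y"
      unfolding p using s by (intro convex_onD[OF \<phi>]) (auto simp: z y)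
    \<comment> \<open>The Bregman terms at \<open>p s\<close> and at \<open>z\<close> differ by
      \<open>\<psi> (p s) - \<psi> z\<close> minus \<open>s\<close> times an inner product, so a
      factor \<open>s\<close> splits off.\<close>
    ultimately have "s * (\<phi> z - \<phi> y + grad \<psi> x \<bullet> (y - z)) \<le> \<psi> (p s) - \<psi> z"
      by (simp add: bregman_def p_def algebra_simps)
    then show "\<phi> z - \<phi> y + grad \<psi> x \<bullet> (y - z) \<le> (\<psi> (p s) - \<psi> z) / s"
      using s by (simp add: field_simps)
  qed simp
  ultimately have "\<phi> z - \<phi> y + grad \<psi> x \<bullet> (y - z) \<le> (y - z) \<bullet> grad \<psi> z"
    by (intro tendsto_lowerbound) auto
  then show ?thesis
    unfolding bregman_three_point by (simp add: algebra_simps inner_commute)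
qed

section \<open>Constraint matrices and the penalty term\<close>

lemma L2_set_inner_le_matrix_norm2:
  "L2_set (\<lambda>k. A k \<bullet> v) {..<d} \<le> matrix_norm2 d A * norm v"
proof (cases "v = 0")
  case True
  then show ?thesis by (simp add: L2_set_def)
next
  case False
  \<comment> \<open>Cauchy-Schwarz in each row bounds the quotient by the Frobenius norm, so the
    supremum is over a bounded set. At \<open>v = 0\<close> the quotient is 0 by the convention for
    division.\<close>
  have "L2_set (\<lambda>k. A k \<bullet> v) {..<d} / norm v \<le> L2_set (\<lambda>k. norm (A k)) {..<d}" for v
  proof -
    have "L2_set (\<lambda>k. A k \<bullet> v) {..<d} = L2_set (\<lambda>k. \<bar>A k \<bullet> v\<bar>) {..<d}"
      by (simp add: L2_set_def)
    also have "\<dots> \<le> L2_set (\<lambda>k. norm (A k) * norm v) {..<d}"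
      by (intro L2_set_mono Cauchy_Schwarz_ineq2) auto
    also have "\<dots> = L2_set (\<lambda>k. norm (A k)) {..<d} * norm v"
      by (rule L2_set_left_distrib[symmetric]) simp
    finally show ?thesis
      by (cases "v = 0") (auto simp: field_simps)
  qed
  then have "bdd_above (range (\<lambda>v. L2_set (\<lambda>k. A k \<bullet> v) {..<d} / norm v))"
    by (auto intro!: bdd_aboveI)
  then have "L2_set (\<lambda>k. A k \<bullet> v) {..<d} / norm v \<le> matrix_norm2 d A"
    unfolding matrix_norm2_def by (rule cSUP_upper[OF UNIV_I])
  with False show ?thesis
    by (simp add: field_simps)
qed

text \<open>
  The subgradients \<open>u\<close> of \<open>f\<close> and \<open>v\<close> of \<open>r\<close> are only bounded jointly, so \<open>r z\<close> has to be
  linearized at \<open>x\<close> as well.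
\<close>

lemma penalized_descent_step:
  fixes \<psi> :: "'a::euclidean_space \<Rightarrow> real" and g :: "'a \<Rightarrow> nat \<Rightarrow> real" and d :: nat
  defines "h \<equiv> \<lambda>x. L2_set (\<lambda>k. max 0 (g x k)) {..<d}"
  assumes X: "convex X" and r: "convex_on X r"
    and diff: "\<psi> differentiable (at z)"
    and min: "is_arg_min (\<lambda>y. \<alpha> * (y \<bullet> \<omega>) + \<alpha> * r y + bregman \<psi> y x) (\<lambda>y. y \<in> X) z"
    and \<omega>: "\<omega> = u + (\<Sum>k<d. (\<gamma> * max 0 (g x k)) *\<^sub>R A k)"
    and u: "u \<in> subdiff f x" and v: "v \<in> subdiff r x" and A: "A \<in> subgrad_matrices d g x"
    and G\<^sub>1: "norm (u + v) \<le> G\<^sub>1" and G\<^sub>2: "matrix_norm2 d A \<le> G\<^sub>2"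
    and \<alpha>: "0 \<le> \<alpha>" and \<gamma>: "0 \<le> \<gamma>" and y: "y \<in> X"
  shows "\<alpha> * (f x + r x - (f y + r y)) + \<alpha> * \<gamma> * ((h x)\<^sup>2 - (\<Sum>k<d. max 0 (g x k) * g y k))
    \<le> (\<alpha> * G\<^sub>1 + \<alpha> * \<gamma> * G\<^sub>2 * h x) * norm (z - x)
       + (bregman \<psi> y x - bregman \<psi> y z - bregman \<psi> z x)"
proof -
  define q where "q k = max 0 (g x k)" for k
  have q0: "0 \<le> q k" for k
    by (simp add: q_def)
  \<comment> \<open>A number and its positive part have the same product with that positive
    part.\<close>
  have hq: "(h x)\<^sup>2 = (\<Sum>k<d. q k * g x k)"
    by (auto simp: h_def L2_set_def sum_nonneg q_def power2_eq_square max_def intro!: sum.cong)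
  have "convex_on X (\<lambda>y. \<alpha> * (y \<bullet> \<omega>) + \<alpha> * r y)"
  proof (rule convex_on_add)
    have "convex_on X (\<lambda>y. y \<bullet> \<omega>)"
      using X by (intro convex_onI) (auto simp: inner_add_left)
    then show "convex_on X (\<lambda>y. \<alpha> * (y \<bullet> \<omega>))"
      by (rule convex_on_cmul[OF \<alpha>])
    show "convex_on X (\<lambda>y. \<alpha> * r y)"
      by (rule convex_on_cmul[OF \<alpha> r])
  qed
  from mirror_descent_step[OF X this diff min y]
  have step: "\<alpha> * ((z - y) \<bullet> \<omega> + (r z - r y)) \<le> bregman \<psi> y x - bregman \<psi> y z - bregman \<psi> z x"
    by (simp add: algebra_simps)
  have "\<bar>(z - x) \<bullet> (u + v)\<bar> \<le> norm (z - x) * norm (u + v)"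
    by (rule Cauchy_Schwarz_ineq2)
  also have "\<dots> \<le> norm (z - x) * G\<^sub>1"
    using G\<^sub>1 by (simp add: mult_left_mono)
  finally have "- (norm (z - x) * G\<^sub>1) \<le> (z - x) \<bullet> (u + v)"
    by linarith
  moreover have "f y \<ge> f x + u \<bullet> (y - x)" "r z \<ge> r x + v \<bullet> (z - x)"
    using u v by (auto simp: subdiff_def)
  ultimately have loss: "f x + r x - (f y + r y) - norm (z - x) * G\<^sub>1 \<le> (z - y) \<bullet> u + (r z - r y)"
    by (simp add: algebra_simps inner_commute)
  \<comment> \<open>The penalty gradient is paired with \<open>z - y\<close>, which splits into
    \<open>z - x\<close> and \<open>x - y\<close>. This is the first part, an error paid for by the
    movement; the second is treated by convexity of \<open>g\<close>.\<close>
  have "\<bar>\<Sum>k<d. q k * (A k \<bullet> (z - x))\<bar> \<le> (\<Sum>k<d. \<bar>q k\<bar> * \<bar>A k \<bullet> (z - x)\<bar>)"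
    by (rule order_trans[OF sum_abs]) (simp add: abs_mult)
  also have "\<dots> \<le> L2_set q {..<d} * L2_set (\<lambda>k. A k \<bullet> (z - x)) {..<d}"
    by (rule L2_set_mult_ineq)
  also have "\<dots> \<le> h x * (G\<^sub>2 * norm (z - x))"
    unfolding h_def q_def
    using L2_set_inner_le_matrix_norm2[of A "z - x" d] mult_right_mono[OF G\<^sub>2, of "norm (z - x)"]
    by (intro mult_left_mono L2_set_nonneg) auto
  finally have far: "- (h x * (G\<^sub>2 * norm (z - x))) \<le> (\<Sum>k<d. q k * (A k \<bullet> (z - x)))"
    by linarith
  have "(\<Sum>k<d. q k * (g x k - g y k)) \<le> (\<Sum>k<d. q k * (A k \<bullet> (x - y)))"
  proof (rule sum_mono, rule mult_left_mono[OF _ q0])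
    fix k assume "k \<in> {..<d}"
    then have "g y k \<ge> g x k + A k \<bullet> (y - x)"
      using A by (auto simp: subgrad_matrices_def subdiff_def)
    then show "g x k - g y k \<le> A k \<bullet> (x - y)"
      by (simp add: algebra_simps)
  qed
  then have "(h x)\<^sup>2 - (\<Sum>k<d. q k * g y k) \<le> (\<Sum>k<d. q k * (A k \<bullet> (x - y)))"
    by (simp add: hq right_diff_distrib sum_subtractf)
  with far have "(h x)\<^sup>2 - (\<Sum>k<d. q k * g y k) - h x * (G\<^sub>2 * norm (z - x))
      \<le> (\<Sum>k<d. q k * (A k \<bullet> (z - y)))"
    by (simp add: algebra_simps sum.distrib sum_subtractf)
  from mult_left_mono[OF this \<gamma>]
  have "\<gamma> * ((h x)\<^sup>2 - (\<Sum>k<d. q k * g y k)) - \<gamma> * h x * G\<^sub>2 * norm (z - x)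
      \<le> (z - y) \<bullet> (\<Sum>k<d. (\<gamma> * q k) *\<^sub>R A k)"
    by (simp add: algebra_simps sum_distrib_left inner_sum_right inner_commute)
  with loss have "f x + r x - (f y + r y) + \<gamma> * ((h x)\<^sup>2 - (\<Sum>k<d. q k * g y k))
      - (G\<^sub>1 + \<gamma> * G\<^sub>2 * h x) * norm (z - x) \<le> (z - y) \<bullet> \<omega> + (r z - r y)"
    by (simp add: \<omega> q_def inner_add_right algebra_simps)
  from mult_left_mono[OF this \<alpha>] step show ?thesis
    by (simp add: q_def algebra_simps)
qed

text \<open>The subgradient is taken at \<open>y\<close>, the point whose value is bounded from
  above, so the bound on the matrix norm is used at \<open>y\<close> only.\<close>

lemma L2_set_pos_part_le:
  fixes g :: "'a::real_inner \<Rightarrow> nat \<Rightarrow> real"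
  assumes "A \<in> subgrad_matrices d g y" and "matrix_norm2 d A \<le> G"
  shows "L2_set (\<lambda>k. max 0 (g y k)) {..<d} \<le> L2_set (\<lambda>k. max 0 (g x k)) {..<d} + G * norm (y - x)"
proof -
  have "L2_set (\<lambda>k. max 0 (g y k)) {..<d} \<le> L2_set (\<lambda>k. max 0 (g x k) + \<bar>A k \<bullet> (y - x)\<bar>) {..<d}"
  proof (rule L2_set_mono)
    fix k assume "k \<in> {..<d}"
    then have "g x k \<ge> g y k + A k \<bullet> (x - y)"
      using assms by (auto simp: subgrad_matrices_def subdiff_def)
    then show "max 0 (g y k) \<le> max 0 (g x k) + \<bar>A k \<bullet> (y - x)\<bar>"
      by (auto simp: algebra_simps)
  qed simp
  also have "\<dots> \<le> L2_set (\<lambda>k. max 0 (g x k)) {..<d} + L2_set (\<lambda>k. \<bar>A k \<bullet> (y - x)\<bar>) {..<d}"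
    by (rule L2_set_triangle_ineq)
  also have "L2_set (\<lambda>k. \<bar>A k \<bullet> (y - x)\<bar>) {..<d} = L2_set (\<lambda>k. A k \<bullet> (y - x)) {..<d}"
    by (simp add: L2_set_def)
  also have "\<dots> \<le> matrix_norm2 d A * norm (y - x)"
    by (rule L2_set_inner_le_matrix_norm2)
  also have "\<dots> \<le> G * norm (y - x)"
    using assms by (simp add: mult_right_mono)
  finally show ?thesis by simp
qed

section \<open>Sums\<close>

text \<open>A discrete form of the comparison with the integral. Weighted Young's inequality for
  \<open>T / (T + 1)\<close> and 1 expresses the concavity of the power \<open>1 - c\<close>, which
  bounds each summand by an increment of the right-hand side.\<close>

lemma sum_powr_neg_le:
  fixes c :: real
  assumes "0 < c" "c < 1"
  shows "(\<Sum>t=1..T. 1 / real t powr c) \<le> real T powr (1 - c) / (1 - c)"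
proof (induction T)
  case 0
  then show ?case by simp
next
  case (Suc T)
  define s where "s = real (Suc T)"
  have s: "s > 0" by (simp add: s_def)
  have "(real T / s) powr (1 - c) * 1 powr c \<le> (1 - c) * (real T / s) + c * 1"
    \<comment> \<open>Young's inequality is applied to positive numbers, so \<open>T = 0\<close> is
      separate; there the power is 0.\<close>
    using assms s Youngs_inequality_0[of "1 - c" c "real T / s" 1] by (cases "T = 0") auto
  then have "(real T powr (1 - c)) / s powr (1 - c) \<le> 1 - (1 - c) / s"
    using s by (simp add: powr_divide field_simps) (simp add: s_def algebra_simps)
  then have "real T powr (1 - c) \<le> (1 - (1 - c) / s) * s powr (1 - c)"
    using s by (simp add: field_simps)
  also have "\<dots> = s powr (1 - c) - (1 - c) * (1 / s powr c)"
    using s by (simp add: powr_diff field_simps)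
  finally have "1 / s powr c \<le> (s powr (1 - c) - real T powr (1 - c)) / (1 - c)"
    using assms by (simp add: field_simps)
  with Suc show ?case
    by (simp add: s_def diff_divide_distrib)
qed

text \<open>Summation by parts: each increase of the weight multiplies a value of
  \<open>\<Phi>\<close> that is at most \<open>M\<close>, and these increases add up to the last
  weight.\<close>

lemma weighted_telescope_le:
  fixes b \<Phi> :: "nat \<Rightarrow> real"
  assumes b: "0 \<le> b 1" "\<And>t. 1 \<le> t \<Longrightarrow> b t \<le> b (Suc t)"
    and \<Phi>: "\<And>t. 1 \<le> t \<Longrightarrow> 0 \<le> \<Phi> t" "\<And>t. 1 \<le> t \<Longrightarrow> \<Phi> t \<le> M"
    and T: "1 \<le> T"
  shows "(\<Sum>t=1..T. b t * (\<Phi> t - \<Phi> (Suc t))) \<le> b T * M"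
proof -
  have "0 \<le> b T"
    using T by (induction rule: dec_induct) (use b in \<open>auto intro: order_trans\<close>)
  \<comment> \<open>The induction carries the boundary term \<open>b T * \<Phi> (Suc T)\<close>, to
    which the next increase of the weight is added.\<close>
  moreover have "(\<Sum>t=1..T. b t * (\<Phi> t - \<Phi> (Suc t))) + b T * \<Phi> (Suc T) \<le> b T * M"
    using T
  proof (induction rule: dec_induct)
    case base
    then show ?case
      using mult_left_mono[OF \<Phi>(2)[of 1] b(1)] by (simp add: algebra_simps)
  next
    case (step t)
    have "(b (Suc t) - b t) * \<Phi> (Suc t) \<le> (b (Suc t) - b t) * M"
      using b(2)[of t] \<Phi>(2)[of "Suc t"] step by (intro mult_left_mono) auto
    with step show ?case
      by (simp add: algebra_simps)
  qed
  moreover have "0 \<le> \<Phi> (Suc T)"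
    by (rule \<Phi>(1)) simp
  ultimately show ?thesis
    using mult_nonneg_nonneg[of "b T" "\<Phi> (Suc T)"] by linarith
qed

text \<open>The first \<open>L\<close> terms are bounded by \<open>D\<close> and all later ones by
  the contraction. Each \<open>e t\<close> is charged at most once per delay \<open>s < L\<close>,
  and the \<open>\<rho>\<close>-fraction of the sum is absorbed on the left.\<close>

lemma sum_le_of_delayed_contraction:
  fixes d e :: "nat \<Rightarrow> real"
  assumes d: "\<And>t. 1 \<le> t \<Longrightarrow> 0 \<le> d t" "\<And>t. 1 \<le> t \<Longrightarrow> d t \<le> D"
    and e: "\<And>t. 1 \<le> t \<Longrightarrow> 0 \<le> e t"
    and contr: "\<And>t. 1 \<le> t \<Longrightarrow> d (t + L) \<le> \<rho> * d t + (\<Sum>s<L. e (t + s))"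
    and \<rho>: "0 \<le> \<rho>" "\<rho> < 1"
  shows "(\<Sum>t=1..T. d t) \<le> real L * (D + (\<Sum>t=1..T. e t)) / (1 - \<rho>)"
proof -
  have D: "0 \<le> D"
    using d[of 1] by simp
  have E: "0 \<le> (\<Sum>t=1..T. e t)" and dT: "0 \<le> (\<Sum>t=1..T. d t)"
    using e d by (auto intro!: sum_nonneg)
  have "(\<Sum>t=1..T. d t) \<le> real L * D + \<rho> * (\<Sum>t=1..T. d t) + real L * (\<Sum>t=1..T. e t)"
  proof (cases "T \<le> L")
    case True
    have "(\<Sum>t=1..T. d t) \<le> (\<Sum>t=1..T. D)"
      using d by (intro sum_mono) auto
    also have "\<dots> \<le> real L * D"
      using True D by (simp add: mult_right_mono)
    finally show ?thesis
      using E dT \<rho> by (simp add: add_increasing2)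
  next
    case False
    then obtain U where T: "T = L + U"
      using le_Suc_ex nle_le by metis
    have "(\<Sum>t=1..T. d t) = (\<Sum>t=1..L. d t) + (\<Sum>t=1..U. d (t + L))"
    proof -
      have "(\<Sum>t=1..T. d t) = (\<Sum>t=1..L. d t) + (\<Sum>t=L+1..L+U. d t)"
        unfolding T by (rule sum.ub_add_nat) simp
      also have "{L+1..L+U} = {1+L..U+L}"
        by (simp only: add.commute)
      finally show ?thesis
        by (simp only: sum.shift_bounds_cl_nat_ivl)
    qed
    moreover have "(\<Sum>t=1..L. d t) \<le> (\<Sum>t=1..L. D)"
      using d by (intro sum_mono) auto
    moreover have "(\<Sum>t=1..U. d (t + L)) \<le> (\<Sum>t=1..U. \<rho> * d t + (\<Sum>s<L. e (t + s)))"
      using contr by (intro sum_mono) auto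
    moreover have "\<rho> * (\<Sum>t=1..U. d t) \<le> \<rho> * (\<Sum>t=1..T. d t)"
      using \<rho> d by (intro mult_left_mono sum_mono2) (auto simp: T)
    \<comment> \<open>After exchanging the sums, every fixed delay \<open>s\<close> merely shifts
      the range, which stays inside \<open>{1..T}\<close>.\<close>
    moreover have "(\<Sum>t=1..U. \<Sum>s<L. e (t + s)) \<le> real L * (\<Sum>t=1..T. e t)"
    proof -
      have "(\<Sum>t=1..U. \<Sum>s<L. e (t + s)) = (\<Sum>s<L. \<Sum>t=1..U. e (t + s))"
        by (rule sum.swap)
      also have "\<dots> = (\<Sum>s<L. \<Sum>t=1+s..U+s. e t)"
        by (simp only: sum.shift_bounds_cl_nat_ivl)
      also have "\<dots> \<le> (\<Sum>s<L. \<Sum>t=1..T. e t)"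
        using e by (intro sum_mono sum_mono2) (auto simp: T)
      finally show ?thesis by simp
    qed
    ultimately show ?thesis
      by (simp add: sum.distrib sum_distrib_left)
  qed
  then have "(\<Sum>t=1..T. d t) * (1 - \<rho>) \<le> real L * (D + (\<Sum>t=1..T. e t))"
    by (simp add: algebra_simps)
  then show ?thesis
    using \<rho> by (simp add: pos_le_divide_eq)
qed

section \<open>Consensus over time-varying networks\<close>

lemma doubly_stochasticD:
  assumes "doubly_stochastic W"
  shows "0 \<le> W $ i $ j" "(\<Sum>j\<in>UNIV. W $ i $ j) = 1" "(\<Sum>i\<in>UNIV. W $ i $ j) = 1"
  using assms by (auto simp: doubly_stochastic_def)

text \<open>
  With \<open>s = 1 - n * \<eta>\<close> the mass left after removing \<open>\<eta>\<close> from each weight, \<open>s\<close> times the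
  difference of the two averages is a nonnegative combination, of total weight \<open>s\<^sup>2\<close>, of
  the differences \<open>y k - y l\<close>.
\<close>

lemma norm_diff_averages_le:
  fixes y :: "'n::finite \<Rightarrow> 'a::real_normed_vector" and a b :: "'n \<Rightarrow> real"
  assumes a: "\<And>k. \<eta> \<le> a k" "(\<Sum>k\<in>UNIV. a k) = 1"
    and b: "\<And>k. \<eta> \<le> b k" "(\<Sum>k\<in>UNIV. b k) = 1"
    and y: "\<And>k l. norm (y k - y l) \<le> \<delta>"
  shows "norm ((\<Sum>k\<in>UNIV. a k *\<^sub>R y k) - (\<Sum>k\<in>UNIV. b k *\<^sub>R y k)) \<le> (1 - real CARD('n) * \<eta>) * \<delta>"
proof -
  define s where "s = 1 - real CARD('n) * \<eta>"
  define a' b' where "a' k = a k - \<eta>" and "b' k = b k - \<eta>" for k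
  have nonneg: "0 \<le> a' k" "0 \<le> b' k" for k
    using a(1)[of k] b(1)[of k] by (auto simp: a'_def b'_def)
  have s: "(\<Sum>k\<in>UNIV. a' k) = s" "(\<Sum>k\<in>UNIV. b' k) = s"
    using a(2) b(2) by (simp_all add: a'_def b'_def s_def sum_subtractf)
  then have s0: "0 \<le> s"
    using nonneg by (metis sum_nonneg)
  define v where "v = (\<Sum>k\<in>UNIV. a k *\<^sub>R y k) - (\<Sum>k\<in>UNIV. b k *\<^sub>R y k)"
  have v: "v = (\<Sum>k\<in>UNIV. a' k *\<^sub>R y k) - (\<Sum>k\<in>UNIV. b' k *\<^sub>R y k)"
    by (simp add: v_def a'_def b'_def scaleR_diff_left sum_subtractf)
  have "norm v \<le> s * \<delta>"
  \<comment> \<open>The factor \<open>s\<close> cannot be cancelled when it is 0, but then all the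
    remaining weights vanish.\<close>
  proof (cases "s = 0")
    case True
    then have "a' k = 0" "b' k = 0" for k
      using s nonneg by (simp_all add: sum_nonneg_eq_0_iff)
    then show ?thesis
      by (simp add: v True)
  next
    case False
    have "s *\<^sub>R v = (\<Sum>k\<in>UNIV. \<Sum>l\<in>UNIV. (a' k * b' l) *\<^sub>R (y k - y l))"
    proof -
      have "(\<Sum>k\<in>UNIV. \<Sum>l\<in>UNIV. (a' k * b' l) *\<^sub>R y k) = s *\<^sub>R (\<Sum>k\<in>UNIV. a' k *\<^sub>R y k)"
        by (simp add: s(2)[symmetric] sum_distrib_left scaleR_sum_left[symmetric]
            scaleR_sum_right mult.commute)
      moreover have "(\<Sum>k\<in>UNIV. \<Sum>l\<in>UNIV. (a' k * b' l) *\<^sub>R y l) = s *\<^sub>R (\<Sum>l\<in>UNIV. b' l *\<^sub>R y l)"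
        by (simp add: s(1)[symmetric] scaleR_scaleR[symmetric] scaleR_sum_right[symmetric]
            scaleR_sum_left[symmetric] del: scaleR_scaleR)
      ultimately show ?thesis
        by (simp add: v scaleR_diff_right sum_subtractf)
    qed
    then have "s * norm v = norm (\<Sum>k\<in>UNIV. \<Sum>l\<in>UNIV. (a' k * b' l) *\<^sub>R (y k - y l))"
      using s0 by (metis abs_of_nonneg norm_scaleR)
    also have "\<dots> \<le> (\<Sum>k\<in>UNIV. \<Sum>l\<in>UNIV. (a' k * b' l) * \<delta>)"
      using nonneg y by (intro sum_norm_le) (auto simp: abs_mult intro!: mult_left_mono)
    also have "\<dots> = s * (s * \<delta>)"
      by (simp add: s sum_distrib_left[symmetric] sum_distrib_right[symmetric] mult.assoc)
    finally show ?thesis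
      using s0 False by simp
  qed
  then show ?thesis
    by (simp add: v_def s_def)
qed

section \<open>Products \<open>W (t + k - 1) ** ... ** W t\<close> of mixing matrices and their
  positivity\<close>

primrec transition :: "(nat \<Rightarrow> real ^ 'n ^ 'n) \<Rightarrow> nat \<Rightarrow> nat \<Rightarrow> real ^ 'n::finite ^ 'n" where
  "transition W t 0 = mat 1"
| "transition W t (Suc k) = W (t + k) ** transition W t k"

lemma transition_Suc_nth:
  "transition W t (Suc k) $ i $ j = (\<Sum>l\<in>UNIV. W (t + k) $ i $ l * transition W t k $ l $ j)"
  by (simp add: matrix_matrix_mult_def)

locale mixing_network =
  fixes E :: "nat \<Rightarrow> ('n::finite \<times> 'n) set" and W :: "nat \<Rightarrow> real ^ 'n ^ 'n"
    and w :: real and B :: nat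
  assumes mixing: "1 \<le> t \<Longrightarrow> mixing_matrix (E t) (W t)"
    and weight_ge: "1 \<le> t \<Longrightarrow> 0 < W t $ i $ j \<Longrightarrow> w \<le> W t $ i $ j"
    and stochastic: "1 \<le> t \<Longrightarrow> doubly_stochastic (W t)"
    and connected: "1 \<le> t \<Longrightarrow> strongly_connected (\<Union>l<B. E (t + l))"
    and w_pos: "0 < w"
begin

lemma W_nonneg: "1 \<le> t \<Longrightarrow> 0 \<le> W t $ i $ j"
  using doubly_stochasticD(1)[OF stochastic] .

lemma sum_W_row: "1 \<le> t \<Longrightarrow> (\<Sum>j\<in>UNIV. W t $ i $ j) = 1"
  using doubly_stochasticD(2)[OF stochastic] .

lemma sum_W_col: "1 \<le> t \<Longrightarrow> (\<Sum>i\<in>UNIV. W t $ i $ j) = 1"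
  using doubly_stochasticD(3)[OF stochastic] .

lemma W_ge:
  assumes "1 \<le> t" "(j, i) \<in> E t \<or> i = j"
  shows "w \<le> W t $ i $ j"
  using assms mixing[of t] weight_ge[of t i j] by (auto simp: mixing_matrix_def)

lemma transition_nonneg: "1 \<le> t \<Longrightarrow> 0 \<le> transition W t k $ i $ j"
proof (induction k arbitrary: i)
  case 0
  then show ?case by (simp add: mat_def)
next
  case (Suc k)
  then show ?case
    unfolding transition_Suc_nth by (intro sum_nonneg mult_nonneg_nonneg W_nonneg) auto
qed

lemma sum_transition: "1 \<le> t \<Longrightarrow> (\<Sum>j\<in>UNIV. transition W t k $ i $ j) = 1"
proof (induction k arbitrary: i)
  case 0
  then show ?case by (simp add: mat_def)
next
  case (Suc k)
  have "(\<Sum>j\<in>UNIV. transition W t (Suc k) $ i $ j)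
      = (\<Sum>l\<in>UNIV. W (t + k) $ i $ l * (\<Sum>j\<in>UNIV. transition W t k $ l $ j))"
    unfolding transition_Suc_nth sum_distrib_left by (rule sum.swap)
  with Suc show ?case
    by (simp add: sum_W_row)
qed

text \<open>The agents that have received enough weight from \<open>j\<close> after \<open>k\<close>
  rounds. The threshold \<open>w ^ k\<close> decreases by exactly the factor \<open>w\<close> that a
  single transfer can cost.\<close>

definition reached :: "nat \<Rightarrow> 'n \<Rightarrow> nat \<Rightarrow> 'n set" where
  "reached t j k = {i. w ^ k \<le> transition W t k $ i $ j}"

text \<open>All terms of the matrix product are nonnegative, so the single path through
  \<open>l\<close> already gives the bound.\<close>

lemma reached_step:
  assumes t: "1 \<le> t" and l: "l \<in> reached t j k" and i: "(l, i) \<in> E (t + k) \<or> i = l"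
  shows "i \<in> reached t j (Suc k)"
proof -
  have "w * w ^ k \<le> W (t + k) $ i $ l * transition W t k $ l $ j"
    using l i t w_pos W_ge[of "t + k" l i] by (intro mult_mono) (auto simp: reached_def W_nonneg)
  also have "\<dots> \<le> transition W t (Suc k) $ i $ j"
    unfolding transition_Suc_nth
    using t by (intro member_le_sum mult_nonneg_nonneg W_nonneg transition_nonneg) auto
  finally show ?thesis
    by (simp add: reached_def)
qed

lemma reached_mono:
  assumes t: "1 \<le> t" and "k \<le> k'"
  shows "reached t j k \<subseteq> reached t j k'"
  using \<open>k \<le> k'\<close> by (induction rule: dec_induct) (use reached_step[OF t] in auto)

text \<open>In a window of \<open>B\<close> rounds some edge leaves the reached set. Self-loops
  preserve the set up to the round of that edge and preserve its new endpoint afterwards.\<close>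

lemma reached_grows:
  assumes t: "1 \<le> t" and ne: "reached t j k \<noteq> {}" "reached t j k \<noteq> UNIV"
  shows "reached t j k \<subset> reached t j (k + B)"
proof -
  let ?R = "reached t j k" and ?E = "\<Union>l<B. E (t + k + l)"
  obtain a b where ab: "a \<in> ?R" "b \<notin> ?R"
    using ne by blast
  have "(a, b) \<in> ?E\<^sup>*"
    using connected[of "t + k"] t by (auto simp: strongly_connected_def)
  \<comment> \<open>A path from a reached to an unreached agent contains an edge that crosses the
    boundary.\<close>
  then obtain p q where pq: "p \<in> ?R" "q \<notin> ?R" "(p, q) \<in> ?E"
    using ab by (induction rule: rtrancl_induct) blast+
  then obtain l where l: "l < B" "(p, q) \<in> E (t + (k + l))"
    by (auto simp: add.assoc)
  have "p \<in> reached t j (k + l)"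
    using reached_mono[OF t, of k "k + l"] pq by auto
  then have "q \<in> reached t j (Suc (k + l))"
    using reached_step[OF t] l by blast
  then have "q \<in> reached t j (k + B)"
    using reached_mono[OF t, of "Suc (k + l)" "k + B"] l by auto
  then show ?thesis
    using reached_mono[OF t, of k "k + B" j] pq by auto
qed

text \<open>Starting from \<open>j\<close> itself, every block of \<open>B\<close> rounds adds at
  least one agent until all are reached.\<close>

lemma transition_ge:
  assumes t: "1 \<le> t"
  shows "w ^ (CARD('n) * B) \<le> transition W t (CARD('n) * B) $ i $ j"
proof -
  have "j \<in> reached t j 0"
    by (simp add: reached_def mat_def)
  then have ne: "reached t j k \<noteq> {}" for k
    using reached_mono[OF t, of 0 k] by auto
  \<comment> \<open>The minimum covers saturation: once every agent is reached, the set stays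
    full.\<close>
  have "min CARD('n) (Suc k) \<le> card (reached t j (k * B))" for k
  proof (induction k)
    case 0
    then show ?case
      using ne[of 0] by (simp add: Suc_le_eq card_gt_0_iff)
  next
    case (Suc k)
    show ?case
    proof (cases "reached t j (k * B) = UNIV")
      case True
      then have "reached t j (Suc k * B) = UNIV"
        using reached_mono[OF t, of "k * B" "Suc k * B" j] by auto
      then show ?thesis by simp
    next
      case False
      then have "card (reached t j (k * B)) < card (reached t j (k * B + B))"
        by (intro psubset_card_mono reached_grows[OF t ne]) auto
      with Suc show ?thesis
        by (simp add: add.commute)
    qed
  qed
  from this[of "CARD('n)"] have "reached t j (CARD('n) * B) = UNIV"
    by (intro card_eq_UNIV_imp_eq_UNIV) (auto intro!: antisym card_mono)
  then show ?thesis
    by (auto simp: reached_def)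
qed

lemma norm_diff_mix_le:
  fixes y :: "'n \<Rightarrow> 'a::real_normed_vector"
  assumes "1 \<le> t" and "\<And>k l. norm (y k - y l) \<le> \<delta>"
  shows "norm ((\<Sum>k\<in>UNIV. W t $ i $ k *\<^sub>R y k) - (\<Sum>k\<in>UNIV. W t $ j $ k *\<^sub>R y k)) \<le> \<delta>"
  using norm_diff_averages_le[of 0 "\<lambda>k. W t $ i $ k" "\<lambda>k. W t $ j $ k" y \<delta>] assms
  by (simp add: W_nonneg sum_W_row)

text \<open>Each round is exact mixing plus a movement. Later mixing has nonnegative rows of sum 1
  and does not amplify earlier errors, so the movements simply add up.\<close>

lemma norm_transition_error_le:
  fixes z :: "'n \<Rightarrow> nat \<Rightarrow> 'a::real_normed_vector"
  defines "e \<equiv> \<lambda>t. \<Sum>i\<in>UNIV. norm (z i (Suc t) - (\<Sum>j\<in>UNIV. W t $ i $ j *\<^sub>R z j t))"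
  assumes t: "1 \<le> t"
  shows "norm (z i (t + k) - (\<Sum>j\<in>UNIV. transition W t k $ i $ j *\<^sub>R z j t)) \<le> (\<Sum>s<k. e (t + s))"
proof (induction k arbitrary: i)
  case 0
  have "(\<Sum>j\<in>UNIV. mat 1 $ i $ j *\<^sub>R z j t) = (\<Sum>j\<in>UNIV. if i = j then z j t else 0)"
    by (intro sum.cong) (auto simp: mat_def)
  then show ?case
    by simp
next
  case (Suc k)
  let ?W = "W (t + k)" and ?y = "\<lambda>l. \<Sum>j\<in>UNIV. transition W t k $ l $ j *\<^sub>R z j t"
  have "(\<Sum>j\<in>UNIV. transition W t (Suc k) $ i $ j *\<^sub>R z j t) = (\<Sum>l\<in>UNIV. ?W $ i $ l *\<^sub>R ?y l)"
    unfolding transition_Suc_nth scaleR_sum_left scaleR_sum_right scaleR_scaleR by (rule sum.swap)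
  then have "z i (t + Suc k) - (\<Sum>j\<in>UNIV. transition W t (Suc k) $ i $ j *\<^sub>R z j t)
      = (z i (Suc (t + k)) - (\<Sum>l\<in>UNIV. ?W $ i $ l *\<^sub>R z l (t + k)))
        + (\<Sum>l\<in>UNIV. ?W $ i $ l *\<^sub>R (z l (t + k) - ?y l))"
    by (simp add: scaleR_diff_right sum_subtractf)
  also have "norm \<dots> \<le> e (t + k) + (\<Sum>s<k. e (t + s))"
  proof (rule norm_triangle_mono)
    show "norm (z i (Suc (t + k)) - (\<Sum>l\<in>UNIV. ?W $ i $ l *\<^sub>R z l (t + k))) \<le> e (t + k)"
      unfolding e_def
      by (rule member_le_sum[where f = "\<lambda>i. norm (z i (Suc (t + k)) - (\<Sum>j\<in>UNIV. ?W $ i $ j *\<^sub>R z j (t + k)))"]) auto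
    have "norm (\<Sum>l\<in>UNIV. ?W $ i $ l *\<^sub>R (z l (t + k) - ?y l))
        \<le> (\<Sum>l\<in>UNIV. ?W $ i $ l * (\<Sum>s<k. e (t + s)))"
      using Suc.IH t by (intro sum_norm_le) (auto simp: W_nonneg intro!: mult_left_mono)
    also have "\<dots> = (\<Sum>s<k. e (t + s))"
      using t by (simp add: sum_distrib_right[symmetric] sum_W_row)
    finally show "norm (\<Sum>l\<in>UNIV. ?W $ i $ l *\<^sub>R (z l (t + k) - ?y l)) \<le> (\<Sum>s<k. e (t + s))" .
  qed
  finally show ?case by simp
qed

text \<open>The diameter \<open>d\<close> of the points \<open>z\<close> is tracked. Over
  \<open>CARD('n) * B\<close> rounds all transition weights are at least \<open>\<eta>\<close>, so
  pure mixing shrinks it by \<open>1 - CARD('n) * \<eta>\<close>; the movements perturb both ends of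
  a difference, hence the factor 2. One more mixing step passes from \<open>z\<close> to
  \<open>x\<close> without enlarging the diameter.\<close>

lemma sum_consensus_error_le:
  fixes z :: "'n \<Rightarrow> nat \<Rightarrow> 'a::real_normed_vector"
  defines "x \<equiv> \<lambda>i t. \<Sum>j\<in>UNIV. W t $ i $ j *\<^sub>R z j t"
  assumes D: "\<And>i j t. 1 \<le> t \<Longrightarrow> norm (z i t - z j t) \<le> D" and w: "w \<le> 1"
  obtains d where "\<And>i j t. 1 \<le> t \<Longrightarrow> norm (x i t - x j t) \<le> d t"
    and "\<And>T. (\<Sum>t=1..T. d t) \<le>
      real (CARD('n) * B) * (D + 2 * (\<Sum>t=1..T. \<Sum>i\<in>UNIV. norm (z i (Suc t) - x i t)))
        / (real CARD('n) * w ^ (CARD('n) * B))"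
proof
  define e where "e t = (\<Sum>i\<in>UNIV. norm (z i (Suc t) - x i t))" for t
  define d where "d t = Max (range (\<lambda>(i, j). norm (z i t - z j t)))" for t
  define L where "L = CARD('n) * B"
  define \<eta> where "\<eta> = w ^ L"
  have le_d: "norm (z i t - z j t) \<le> d t" for i j t
    unfolding d_def by (rule Max_ge) (auto intro!: range_eqI[of _ _ "(i, j)"])
  have d_le: "d t \<le> M" if "\<And>i j. norm (z i t - z j t) \<le> M" for t M
    unfolding d_def using that by (subst Max_le_iff) auto
  show "norm (x i t - x j t) \<le> d t" if "1 \<le> t" for i j t
    unfolding x_def by (rule norm_diff_mix_le[OF that le_d])
  have \<eta>: "0 < \<eta>" and n\<eta>: "real CARD('n) * \<eta> \<le> 1"
  proof -
    show "0 < \<eta>" by (simp add: \<eta>_def w_pos)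
    \<comment> \<open>A row of the transition matrix sums to 1 and has all entries at least
      \<open>\<eta>\<close>, so the contraction factor is nonnegative. The row
      \<open>undefined\<close> is an arbitrary one.\<close>
    have "(\<Sum>j\<in>(UNIV :: 'n set). \<eta>) \<le> (\<Sum>j\<in>UNIV. transition W 1 L $ undefined $ j)"
      unfolding \<eta>_def L_def by (intro sum_mono transition_ge) simp
    then show "real CARD('n) * \<eta> \<le> 1"
      by (simp only: sum_transition order_refl) simp
  qed
  have contr: "d (t + L) \<le> (1 - real CARD('n) * \<eta>) * d t + (\<Sum>s<L. 2 * e (t + s))" if t: "1 \<le> t" for t
  proof (rule d_le)
    fix i j
    let ?y = "\<lambda>i. \<Sum>k\<in>UNIV. transition W t L $ i $ k *\<^sub>R z k t"
    have y: "norm (z i (t + L) - ?y i) \<le> (\<Sum>s<L. e (t + s))" for i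
      using norm_transition_error_le[OF t, of z i L] by (simp add: e_def x_def)
    have "norm (?y i - ?y j) \<le> (1 - real CARD('n) * \<eta>) * d t"
      unfolding \<eta>_def L_def
      by (intro norm_diff_averages_le transition_ge sum_transition t le_d)
    moreover have "norm (z i (t + L) - z j (t + L))
        \<le> norm (z i (t + L) - ?y i) + norm (?y i - ?y j) + norm (z j (t + L) - ?y j)"
      using norm_triangle_ineq4[of "z i (t + L) - ?y i + (?y i - ?y j)" "z j (t + L) - ?y j"]
        norm_triangle_ineq[of "z i (t + L) - ?y i" "?y i - ?y j"]
      by simp
    ultimately show "norm (z i (t + L) - z j (t + L))
        \<le> (1 - real CARD('n) * \<eta>) * d t + (\<Sum>s<L. 2 * e (t + s))"
      using y[of i] y[of j] by (simp add: sum_distrib_left[symmetric])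
  qed
  have "0 \<le> d t" for t
    using le_d[of undefined t undefined] by simp
  moreover have "d t \<le> D" if "1 \<le> t" for t
    using D[OF that] by (rule d_le)
  moreover have "0 \<le> 2 * e t" for t
    by (simp add: e_def sum_nonneg)
  ultimately have "(\<Sum>t=1..T. d t) \<le> real L * (D + (\<Sum>t=1..T. 2 * e t)) / (1 - (1 - real CARD('n) * \<eta>))" for T
    using contr \<eta> n\<eta> by (intro sum_le_of_delayed_contraction) auto
  then show "(\<Sum>t=1..T. d t) \<le>
      real (CARD('n) * B) * (D + 2 * (\<Sum>t=1..T. \<Sum>i\<in>UNIV. norm (z i (Suc t) - x i t)))
        / (real CARD('n) * w ^ (CARD('n) * B))" for T
    by (simp add: L_def \<eta>_def e_def sum_distrib_left[symmetric])
qed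

end

section \<open>The primal-dual algorithm\<close>

locale rate_constants =
  fixes n B :: nat and F G\<^sub>1 G\<^sub>2 w \<sigma> K \<epsilon>\<^sub>s c \<gamma>\<^sub>0 :: real
  assumes n_pos: "0 < n" and B_pos: "0 < B" and F_pos: "0 < F" and G\<^sub>1_pos: "0 < G\<^sub>1" and G\<^sub>2_pos: "0 < G\<^sub>2"
    and weight_bounds: "0 < w" "w < 1" and \<sigma>_pos: "0 < \<sigma>" and K_pos: "0 < K" and \<epsilon>\<^sub>s_pos: "0 < \<epsilon>\<^sub>s"
    and c_bounds: "0 < c" "c < 1" and \<gamma>\<^sub>0_pos: "0 < \<gamma>\<^sub>0" and \<gamma>\<^sub>0_le: "\<gamma>\<^sub>0 \<le> \<sigma> / (4 * G\<^sub>2\<^sup>2)"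
begin

text \<open>This and the next two constants are the coefficients of \<open>T powr (1 - c)\<close>
  for the summed local violations, movements and consensus errors, each feeding the next. Here the
  numerator collects the loss gap, the step-size error and the initial potential; the denominator is
  the gain from Slater's point.\<close>

definition penalty_const :: real where
  "penalty_const = real n * ((F + G\<^sub>1\<^sup>2 / \<sigma>) / (1 - c) + K) / (\<gamma>\<^sub>0 * \<epsilon>\<^sub>s)"

definition movement_const :: real where
  "movement_const = (real n * G\<^sub>1 / (1 - c) + \<gamma>\<^sub>0 * G\<^sub>2 * penalty_const) / \<sigma>"

text \<open>The square root is the bound on the diameter of \<open>X\<close>, which serves as the
  initial spread of the agents.\<close>

definition consensus_const :: real where
  "consensus_const = real (n * B) * (sqrt (2 * K / \<sigma>) + 2 * movement_const) / (real n * w ^ (n * B))"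

definition regret_const :: real where
  "regret_const = G\<^sub>1\<^sup>2 / (\<sigma> * (1 - c)) + K + G\<^sub>1 * consensus_const"

definition violation_const :: real where
  "violation_const = penalty_const + real n * G\<^sub>2 * consensus_const"

lemma penalty_const_pos: "0 < penalty_const"
proof -
  have "0 < (F + G\<^sub>1\<^sup>2 / \<sigma>) / (1 - c) + K"
    using c_bounds F_pos \<sigma>_pos K_pos by (intro add_nonneg_pos divide_nonneg_nonneg add_nonneg_nonneg) auto
  then show ?thesis
    using n_pos \<gamma>\<^sub>0_pos \<epsilon>\<^sub>s_pos by (simp add: penalty_const_def)
qed

lemma movement_const_pos: "0 < movement_const"
  using penalty_const_pos c_bounds n_pos G\<^sub>1_pos G\<^sub>2_pos \<gamma>\<^sub>0_pos \<sigma>_pos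
  by (auto simp: movement_const_def intro!: divide_pos_pos add_pos_pos)

lemma consensus_const_pos: "0 < consensus_const"
  using movement_const_pos n_pos B_pos weight_bounds K_pos \<sigma>_pos
  by (auto simp: consensus_const_def intro!: divide_pos_pos mult_pos_pos add_nonneg_pos)

lemma regret_const_pos: "0 < regret_const"
  using consensus_const_pos K_pos G\<^sub>1_pos c_bounds \<sigma>_pos
  by (auto simp: regret_const_def intro!: add_nonneg_pos add_pos_pos)

lemma violation_const_pos: "0 < violation_const"
  using penalty_const_pos consensus_const_pos n_pos G\<^sub>2_pos
  by (auto simp: violation_const_def intro!: add_pos_pos)

end

text \<open>A single run with its choice of subgradients \<open>u\<close> and \<open>A\<close>
  fixed; the auxiliary \<open>q\<close> and \<open>\<omega>\<close> are substituted into the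
  minimization.\<close>

locale primal_dual_run =
  rate_constants "CARD('n)" B F G\<^sub>1 G\<^sub>2 w \<sigma> K \<epsilon>\<^sub>s c \<gamma>\<^sub>0 + mixing_network E W w B
  for E :: "nat \<Rightarrow> ('n::finite \<times> 'n) set" and W :: "nat \<Rightarrow> real ^ 'n ^ 'n"
    and B F G\<^sub>1 G\<^sub>2 w \<sigma> K \<epsilon>\<^sub>s c \<gamma>\<^sub>0 +
  fixes X :: "'a::euclidean_space set" and m :: "'n \<Rightarrow> nat"
    and f :: "'n \<Rightarrow> nat \<Rightarrow> 'a \<Rightarrow> real" and r :: "nat \<Rightarrow> 'a \<Rightarrow> real"
    and g :: "'n \<Rightarrow> nat \<Rightarrow> 'a \<Rightarrow> nat \<Rightarrow> real" and \<psi> :: "'a \<Rightarrow> real" and \<alpha> \<gamma> :: "nat \<Rightarrow> real"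
    and z x u :: "'n \<Rightarrow> nat \<Rightarrow> 'a" and A :: "'n \<Rightarrow> nat \<Rightarrow> nat \<Rightarrow> 'a" and x\<^sub>s :: 'a
  assumes X: "convex X"
    and \<psi>: "y \<in> X \<Longrightarrow> \<psi> differentiable (at y)" "strongly_convex_on X \<sigma> \<psi>"
    and convex_r: "1 \<le> t \<Longrightarrow> convex_on X (r t)"
    and loss_diff_le: "1 \<le> t \<Longrightarrow> y \<in> X \<Longrightarrow> y' \<in> X \<Longrightarrow> \<bar>local_loss f r i t y - local_loss f r i t y'\<bar> \<le> F"
    and subdiff_nonempty: "1 \<le> t \<Longrightarrow> y \<in> X \<Longrightarrow> subdiff (r t) y \<noteq> {}"
      "1 \<le> t \<Longrightarrow> y \<in> X \<Longrightarrow> subdiff (f i t) y \<noteq> {}"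
      "1 \<le> t \<Longrightarrow> y \<in> X \<Longrightarrow> subgrad_matrices (m i) (g i t) y \<noteq> {}"
    and subgrad_le: "1 \<le> t \<Longrightarrow> y \<in> X \<Longrightarrow> a \<in> subdiff (f i t) y \<Longrightarrow> v \<in> subdiff (r t) y \<Longrightarrow> norm (a + v) \<le> G\<^sub>1"
    and subgrad_matrix_le: "1 \<le> t \<Longrightarrow> y \<in> X \<Longrightarrow> M \<in> subgrad_matrices (m i) (g i t) y \<Longrightarrow> matrix_norm2 (m i) M \<le> G\<^sub>2"
    and convex_bregman: "y \<in> X \<Longrightarrow> convex_on X (bregman \<psi> y)"
    and bregman_le: "y \<in> X \<Longrightarrow> y' \<in> X \<Longrightarrow> bregman \<psi> y y' \<le> K"
    and slater: "x\<^sub>s \<in> X" "1 \<le> t \<Longrightarrow> k < m i \<Longrightarrow> g i t x\<^sub>s k \<le> - \<epsilon>\<^sub>s"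
    and \<alpha>: "1 \<le> t \<Longrightarrow> \<alpha> t = 1 / real t powr c" and \<gamma>: "1 \<le> t \<Longrightarrow> \<gamma> t = \<gamma>\<^sub>0 / \<alpha> t"
    and z1_in: "z i 1 \<in> X"
    and x_eq: "1 \<le> t \<Longrightarrow> x i t = (\<Sum>j\<in>UNIV. W t $ i $ j *\<^sub>R z j t)"
    and u_in: "1 \<le> t \<Longrightarrow> u i t \<in> subdiff (f i t) (x i t)"
    and A_in: "1 \<le> t \<Longrightarrow> A i t \<in> subgrad_matrices (m i) (g i t) (x i t)"
    and z_Suc: "1 \<le> t \<Longrightarrow>
      is_arg_min (\<lambda>y. \<alpha> t * (y \<bullet> (u i t + (\<Sum>k<m i. (\<gamma> t * max 0 (g i t (x i t) k)) *\<^sub>R A i t k)))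
        + \<alpha> t * r t y + bregman \<psi> y (x i t)) (\<lambda>y. y \<in> X) (z i (Suc t))"
begin

abbreviation loss :: "'n \<Rightarrow> nat \<Rightarrow> 'a \<Rightarrow> real" where
  "loss \<equiv> local_loss f r"

definition pos_part_norm :: "'n \<Rightarrow> nat \<Rightarrow> 'a \<Rightarrow> real" where
  "pos_part_norm i t y = L2_set (\<lambda>k. max 0 (g i t y k)) {..<m i}"

abbreviation h :: "'n \<Rightarrow> nat \<Rightarrow> real" where
  "h i t \<equiv> pos_part_norm i t (x i t)"

abbreviation e :: "'n \<Rightarrow> nat \<Rightarrow> real" where
  "e i t \<equiv> norm (z i (Suc t) - x i t)"

text \<open>The Lyapunov function of the run, measured at the points before mixing.\<close>

definition potential :: "'a \<Rightarrow> nat \<Rightarrow> real" where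
  "potential y t = (\<Sum>i\<in>UNIV. bregman \<psi> y (z i t))"

lemma h_nonneg: "0 \<le> pos_part_norm i t y"
  by (simp add: pos_part_norm_def)

lemma \<alpha>_pos: "1 \<le> t \<Longrightarrow> 0 < \<alpha> t"
  by (simp add: \<alpha>)

lemma \<alpha>_le_1: "1 \<le> t \<Longrightarrow> \<alpha> t \<le> 1"
  using c_bounds by (simp add: \<alpha> ge_one_powr_ge_zero)

lemma \<alpha>_\<gamma>: "1 \<le> t \<Longrightarrow> \<alpha> t * \<gamma> t = \<gamma>\<^sub>0"
  using \<alpha>_pos[of t] by (simp add: \<gamma>)

lemma \<gamma>_nonneg: "1 \<le> t \<Longrightarrow> 0 \<le> \<gamma> t"
  using \<alpha>_pos[of t] \<gamma>\<^sub>0_pos by (simp add: \<gamma>)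

lemma sum_\<alpha>_le: "(\<Sum>t=1..T. \<alpha> t) \<le> real T powr (1 - c) / (1 - c)"
proof -
  have "(\<Sum>t=1..T. \<alpha> t) = (\<Sum>t=1..T. 1 / real t powr c)"
    by (intro sum.cong) (auto simp: \<alpha>)
  then show ?thesis
    using sum_powr_neg_le[OF c_bounds, of T] by simp
qed

lemma z_in: "1 \<le> t \<Longrightarrow> z i t \<in> X"
proof (induction rule: dec_induct)
  case base
  then show ?case by (rule z1_in)
next
  case (step t)
  then show ?case
    using z_Suc[of t i] by (simp add: is_arg_min_linorder)
qed

lemma x_in: "1 \<le> t \<Longrightarrow> x i t \<in> X"
  unfolding x_eq by (rule convex_sum) (auto simp: X sum_W_row W_nonneg z_in)

lemma bregman_ge: "y \<in> X \<Longrightarrow> y' \<in> X \<Longrightarrow> \<sigma> / 2 * (norm (y - y'))\<^sup>2 \<le> bregman \<psi> y y'"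
  using strongly_convex_on_bregman_ge[OF \<psi>(2)] .

lemma bregman_nonneg: "y \<in> X \<Longrightarrow> y' \<in> X \<Longrightarrow> 0 \<le> bregman \<psi> y y'"
  using bregman_ge[of y y'] \<sigma>_pos by (smt (verit) mult_nonneg_nonneg zero_le_power2 divide_nonneg_nonneg)

text \<open>Strong convexity turns the bound on the Bregman divergence into one on the diameter of
  \<open>X\<close>.\<close>

lemma norm_diff_le:
  assumes "y \<in> X" "y' \<in> X"
  shows "norm (y - y') \<le> sqrt (2 * K / \<sigma>)"
proof (rule real_le_rsqrt)
  have "\<sigma> / 2 * (norm (y - y'))\<^sup>2 \<le> K"
    using bregman_ge[OF assms] bregman_le[OF assms] by simp
  then show "(norm (y - y'))\<^sup>2 \<le> 2 * K / \<sigma>"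
    using \<sigma>_pos by (simp add: field_simps)
qed

section \<open>Inequalities for a single round\<close>

lemma descent_step:
  assumes t: "1 \<le> t" and y: "y \<in> X"
  shows "\<alpha> t * (loss i t (x i t) - loss i t y)
      + \<gamma>\<^sub>0 * ((h i t)\<^sup>2 - (\<Sum>k<m i. max 0 (g i t (x i t) k) * g i t y k))
    \<le> (\<alpha> t * G\<^sub>1 + \<gamma>\<^sub>0 * G\<^sub>2 * h i t) * e i t
      + (bregman \<psi> y (x i t) - bregman \<psi> y (z i (Suc t)) - bregman \<psi> (z i (Suc t)) (x i t))"
proof -
  obtain v where v: "v \<in> subdiff (r t) (x i t)"
    using subdiff_nonempty(1)[OF t x_in[OF t]] by blast
  have "\<psi> differentiable at (z i (Suc t))"
    by (rule \<psi>(1)) (simp add: z_in)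
  from penalized_descent_step[OF X convex_r[OF t] this z_Suc[OF t] refl u_in[OF t] v A_in[OF t]
      subgrad_le[OF t x_in[OF t] u_in[OF t] v] subgrad_matrix_le[OF t x_in[OF t] A_in[OF t]]
      less_imp_le[OF \<alpha>_pos[OF t]] \<gamma>_nonneg[OF t] y]
  show ?thesis
    by (simp add: \<alpha>_\<gamma>[OF t] local_loss_def pos_part_norm_def)
qed

text \<open>With the current iterate as comparator, losses and penalty cancel. The two remaining
  Bregman terms are each at least \<open>\<sigma> / 2\<close> times the squared movement, and one
  factor of the movement is cancelled.\<close>

lemma movement_le:
  assumes t: "1 \<le> t"
  shows "\<sigma> * e i t \<le> \<alpha> t * G\<^sub>1 + \<gamma>\<^sub>0 * G\<^sub>2 * h i t"
proof (cases "e i t = 0")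
  case True
  then show ?thesis
    using \<alpha>_pos[OF t] G\<^sub>1_pos G\<^sub>2_pos \<gamma>\<^sub>0_pos h_nonneg[of i t "x i t"] by (simp add: add_nonneg_nonneg)
next
  case False
  have "(h i t)\<^sup>2 = (\<Sum>k<m i. max 0 (g i t (x i t) k) * g i t (x i t) k)"
    by (auto simp: pos_part_norm_def L2_set_def sum_nonneg power2_eq_square max_def intro!: sum.cong)
  with descent_step[OF t x_in[OF t], of i i]
  have "bregman \<psi> (x i t) (z i (Suc t)) + bregman \<psi> (z i (Suc t)) (x i t)
      \<le> (\<alpha> t * G\<^sub>1 + \<gamma>\<^sub>0 * G\<^sub>2 * h i t) * e i t"
    by simp
  moreover have "\<sigma> / 2 * (e i t)\<^sup>2 \<le> bregman \<psi> (x i t) (z i (Suc t))"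
    using bregman_ge[of "x i t" "z i (Suc t)"] by (simp add: x_in[OF t] z_in norm_minus_commute)
  moreover have "\<sigma> / 2 * (e i t)\<^sup>2 \<le> bregman \<psi> (z i (Suc t)) (x i t)"
    by (rule bregman_ge) (simp_all add: x_in[OF t] z_in)
  ultimately have "(\<sigma> * e i t) * e i t \<le> (\<alpha> t * G\<^sub>1 + \<gamma>\<^sub>0 * G\<^sub>2 * h i t) * e i t"
    by (simp add: power2_eq_square)
  then show ?thesis
    using False by (simp add: mult_le_cancel_right)
qed

text \<open>Both products with the movement are split by Young's inequality. The squared movements
  cost \<open>\<sigma> / 4 + \<sigma> / 16\<close>, less than the \<open>\<sigma> / 2\<close>
  supplied by strong convexity, and the penalty square pays for the rest of the constraint
  term.\<close>

lemma energy_step: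
  assumes t: "1 \<le> t" and y: "y \<in> X"
  shows "\<alpha> t * (loss i t (x i t) - loss i t y) - \<gamma>\<^sub>0 * (\<Sum>k<m i. max 0 (g i t (x i t) k) * g i t y k)
    \<le> (\<alpha> t)\<^sup>2 * G\<^sub>1\<^sup>2 / \<sigma> + (bregman \<psi> y (x i t) - bregman \<psi> y (z i (Suc t)))"
proof -
  have "\<alpha> t * G\<^sub>1 * e i t \<le> (\<alpha> t)\<^sup>2 * G\<^sub>1\<^sup>2 / \<sigma> + \<sigma> / 4 * (e i t)\<^sup>2"
  proof -
    have "0 \<le> (2 * \<alpha> t * G\<^sub>1 - \<sigma> * e i t)\<^sup>2"
      by simp
    then have "4 * \<sigma> * (\<alpha> t * G\<^sub>1 * e i t) \<le> 4 * ((\<alpha> t)\<^sup>2 * G\<^sub>1\<^sup>2) + \<sigma> * \<sigma> * (e i t)\<^sup>2"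
      by (simp add: power2_eq_square algebra_simps)
    then show ?thesis
      using \<sigma>_pos by (simp add: field_simps power2_eq_square)
  qed
  moreover have "\<gamma>\<^sub>0 * G\<^sub>2 * h i t * e i t \<le> \<gamma>\<^sub>0 * (h i t)\<^sup>2 + \<sigma> / 16 * (e i t)\<^sup>2"
  proof -
    have "0 \<le> \<gamma>\<^sub>0 * (h i t - G\<^sub>2 * e i t / 2)\<^sup>2"
      using \<gamma>\<^sub>0_pos by simp
    then have "\<gamma>\<^sub>0 * G\<^sub>2 * h i t * e i t \<le> \<gamma>\<^sub>0 * (h i t)\<^sup>2 + (\<gamma>\<^sub>0 * G\<^sub>2\<^sup>2) / 4 * (e i t)\<^sup>2"
      by (simp add: power2_eq_square algebra_simps)
    \<comment> \<open>The condition on \<open>\<gamma>\<^sub>0\<close> enters here.\<close>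
    moreover have "\<gamma>\<^sub>0 * G\<^sub>2\<^sup>2 \<le> \<sigma> / 4"
      using \<gamma>\<^sub>0_le G\<^sub>2_pos by (simp add: field_simps)
    then have "(\<gamma>\<^sub>0 * G\<^sub>2\<^sup>2) / 4 * (e i t)\<^sup>2 \<le> \<sigma> / 16 * (e i t)\<^sup>2"
      by (intro mult_right_mono) auto
    ultimately show ?thesis
      by linarith
  qed
  moreover have "\<sigma> / 2 * (e i t)\<^sup>2 \<le> bregman \<psi> (z i (Suc t)) (x i t)"
    by (rule bregman_ge) (simp_all add: x_in[OF t] z_in)
  moreover have "0 \<le> \<sigma> * (e i t)\<^sup>2"
    using \<sigma>_pos by simp
  ultimately show ?thesis
    using descent_step[OF t y, of i] by (simp add: algebra_simps)
qed

text \<open>Jensen's inequality uses the row sums; exchanging the sums then uses the column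
  sums.\<close>

lemma sum_bregman_mix_le:
  assumes t: "1 \<le> t" and y: "y \<in> X"
  shows "(\<Sum>i\<in>UNIV. bregman \<psi> y (x i t)) \<le> potential y t"
proof -
  have "(\<Sum>i\<in>UNIV. bregman \<psi> y (x i t)) \<le> (\<Sum>i\<in>UNIV. \<Sum>j\<in>UNIV. W t $ i $ j * bregman \<psi> y (z j t))"
    unfolding x_eq[OF t]
    by (intro sum_mono convex_on_sum[OF _ _ convex_bregman[OF y]])
      (auto simp: sum_W_row[OF t] W_nonneg[OF t] z_in[OF t])
  also have "\<dots> = (\<Sum>j\<in>UNIV. (\<Sum>i\<in>UNIV. W t $ i $ j) * bregman \<psi> y (z j t))"
    unfolding sum_distrib_right by (rule sum.swap)
  finally show ?thesis
    by (simp add: sum_W_col[OF t] potential_def)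
qed

lemma network_energy_step:
  assumes t: "1 \<le> t" and y: "y \<in> X"
  shows "\<alpha> t * (\<Sum>i\<in>UNIV. loss i t (x i t) - loss i t y)
      - \<gamma>\<^sub>0 * (\<Sum>i\<in>UNIV. \<Sum>k<m i. max 0 (g i t (x i t) k) * g i t y k)
    \<le> real CARD('n) * ((\<alpha> t)\<^sup>2 * G\<^sub>1\<^sup>2 / \<sigma>) + (potential y t - potential y (Suc t))"
proof -
  have "(\<Sum>i\<in>UNIV. \<alpha> t * (loss i t (x i t) - loss i t y)
      - \<gamma>\<^sub>0 * (\<Sum>k<m i. max 0 (g i t (x i t) k) * g i t y k))
    \<le> (\<Sum>i\<in>UNIV. (\<alpha> t)\<^sup>2 * G\<^sub>1\<^sup>2 / \<sigma> + (bregman \<psi> y (x i t) - bregman \<psi> y (z i (Suc t))))"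
    by (intro sum_mono energy_step t y)
  then show ?thesis
    using sum_bregman_mix_le[OF t y]
    by (simp add: sum.distrib sum_subtractf sum_distrib_left[symmetric] potential_def)
qed

section \<open>Cumulative bounds over the horizon\<close>

lemma potential_nonneg: "1 \<le> t \<Longrightarrow> y \<in> X \<Longrightarrow> 0 \<le> potential y t"
  unfolding potential_def by (intro sum_nonneg bregman_nonneg z_in)

lemma potential_le: "1 \<le> t \<Longrightarrow> y \<in> X \<Longrightarrow> potential y t \<le> real CARD('n) * K"
  unfolding potential_def using sum_bounded_above[of UNIV "\<lambda>i. bregman \<psi> y (z i t)" K]
  by (simp add: bregman_le z_in)

text \<open>With Slater's point as comparator the penalty term has a strictly negative margin. Every
  other contribution is of order \<open>\<alpha> t\<close> or telescopes, so no division by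
  \<open>\<alpha> t\<close> occurs.\<close>

lemma sum_h_le:
  assumes T: "1 \<le> T"
  shows "(\<Sum>t=1..T. \<Sum>i\<in>UNIV. h i t) \<le> penalty_const * real T powr (1 - c)"
proof -
  define N where "N = real CARD('n)"
  define Q where "Q = N * (F + G\<^sub>1\<^sup>2 / \<sigma>)"
  have step: "\<gamma>\<^sub>0 * \<epsilon>\<^sub>s * (\<Sum>i\<in>UNIV. h i t) \<le> Q * \<alpha> t + 1 * (potential x\<^sub>s t - potential x\<^sub>s (Suc t))"
    if t: "1 \<le> t" for t
  proof -
    have "(\<Sum>i\<in>UNIV. \<Sum>k<m i. max 0 (g i t (x i t) k) * g i t x\<^sub>s k) \<le> (\<Sum>i\<in>UNIV. - \<epsilon>\<^sub>s * h i t)"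
    proof (rule sum_mono)
      fix i
      have "(\<Sum>k<m i. max 0 (g i t (x i t) k) * g i t x\<^sub>s k) \<le> (\<Sum>k<m i. max 0 (g i t (x i t) k) * - \<epsilon>\<^sub>s)"
        using slater(2)[OF t] by (intro sum_mono mult_left_mono) auto
      also have "\<dots> = - (\<epsilon>\<^sub>s * (\<Sum>k<m i. max 0 (g i t (x i t) k)))"
        by (simp add: sum_distrib_left sum_negf mult.commute)
      \<comment> \<open>The sum of the positive parts dominates their Euclidean norm.\<close>
      also have "\<dots> \<le> - (\<epsilon>\<^sub>s * h i t)"
        using \<epsilon>\<^sub>s_pos L2_set_le_sum[of "{..<m i}" "\<lambda>k. max 0 (g i t (x i t) k)"]
        by (simp add: pos_part_norm_def)
      finally show "(\<Sum>k<m i. max 0 (g i t (x i t) k) * g i t x\<^sub>s k) \<le> - \<epsilon>\<^sub>s * h i t"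
        by simp
    qed
    then have "\<gamma>\<^sub>0 * (\<Sum>i\<in>UNIV. \<Sum>k<m i. max 0 (g i t (x i t) k) * g i t x\<^sub>s k)
        \<le> \<gamma>\<^sub>0 * (- \<epsilon>\<^sub>s * (\<Sum>i\<in>UNIV. h i t))"
      using \<gamma>\<^sub>0_pos by (intro mult_left_mono) (auto simp: sum_distrib_left)
    moreover have "\<alpha> t * (\<Sum>i\<in>UNIV. loss i t (x i t) - loss i t x\<^sub>s) \<ge> \<alpha> t * - (N * F)"
    proof (intro mult_left_mono less_imp_le[OF \<alpha>_pos[OF t]])
      have "(\<Sum>i\<in>(UNIV :: 'n set). - F) \<le> (\<Sum>i\<in>UNIV. loss i t (x i t) - loss i t x\<^sub>s)"
      proof (rule sum_mono)
        fix i
        show "- F \<le> loss i t (x i t) - loss i t x\<^sub>s"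
          using loss_diff_le[OF t x_in[OF t, of i] slater(1), of i] by simp
      qed
      then show "- (N * F) \<le> (\<Sum>i\<in>UNIV. loss i t (x i t) - loss i t x\<^sub>s)"
        by (simp add: N_def)
    qed
    \<comment> \<open>Since \<open>\<alpha> t \<le> 1\<close>, the quadratic error is merged with
      the linear one.\<close>
    moreover have "N * ((\<alpha> t)\<^sup>2 * G\<^sub>1\<^sup>2 / \<sigma>) \<le> N * (\<alpha> t * G\<^sub>1\<^sup>2 / \<sigma>)"
      using \<alpha>_pos[OF t] \<alpha>_le_1[OF t] \<sigma>_pos
      by (intro mult_left_mono divide_right_mono mult_right_mono)
        (auto simp: N_def power2_eq_square mult_left_le)
    ultimately show ?thesis
      using network_energy_step[OF t slater(1)] by (simp add: N_def[symmetric] Q_def algebra_simps)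
  qed
  have "\<gamma>\<^sub>0 * \<epsilon>\<^sub>s * (\<Sum>t=1..T. \<Sum>i\<in>UNIV. h i t)
      \<le> (\<Sum>t=1..T. Q * \<alpha> t + 1 * (potential x\<^sub>s t - potential x\<^sub>s (Suc t)))"
    by (subst sum_distrib_left, rule sum_mono, rule step) simp
  also have "\<dots> = Q * (\<Sum>t=1..T. \<alpha> t) + (\<Sum>t=1..T. 1 * (potential x\<^sub>s t - potential x\<^sub>s (Suc t)))"
    by (simp add: sum.distrib sum_distrib_left)
  also have "\<dots> \<le> Q * (real T powr (1 - c) / (1 - c)) + 1 * (N * K)"
  proof (rule add_mono)
    show "Q * (\<Sum>t=1..T. \<alpha> t) \<le> Q * (real T powr (1 - c) / (1 - c))"
      using F_pos \<sigma>_pos by (intro mult_left_mono sum_\<alpha>_le) (auto simp: Q_def N_def)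
    show "(\<Sum>t=1..T. 1 * (potential x\<^sub>s t - potential x\<^sub>s (Suc t))) \<le> 1 * (N * K)"
      using T potential_nonneg[OF _ slater(1)] potential_le[OF _ slater(1)]
      by (intro weighted_telescope_le[where b = "\<lambda>_. 1"]) (auto simp: N_def)
  qed
  also have "1 * (N * K) \<le> N * K * real T powr (1 - c)"
    using T K_pos c_bounds by (simp add: N_def ge_one_powr_ge_zero)
  finally have "\<gamma>\<^sub>0 * \<epsilon>\<^sub>s * (\<Sum>t=1..T. \<Sum>i\<in>UNIV. h i t) \<le> (Q / (1 - c) + N * K) * real T powr (1 - c)"
    by (simp add: algebra_simps)
  also have "Q / (1 - c) + N * K = \<gamma>\<^sub>0 * \<epsilon>\<^sub>s * penalty_const"
    using \<gamma>\<^sub>0_pos \<epsilon>\<^sub>s_pos by (simp add: penalty_const_def Q_def N_def field_simps)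
  finally show ?thesis
    using \<gamma>\<^sub>0_pos \<epsilon>\<^sub>s_pos by (simp add: mult.assoc)
qed

lemma sum_e_le:
  assumes T: "1 \<le> T"
  shows "(\<Sum>t=1..T. \<Sum>i\<in>UNIV. e i t) \<le> movement_const * real T powr (1 - c)"
proof -
  have "\<sigma> * (\<Sum>t=1..T. \<Sum>i\<in>UNIV. e i t) \<le> (\<Sum>t=1..T. \<Sum>i\<in>UNIV. \<alpha> t * G\<^sub>1 + \<gamma>\<^sub>0 * G\<^sub>2 * h i t)"
    unfolding sum_distrib_left by (intro sum_mono movement_le) auto
  also have "\<dots> = real CARD('n) * G\<^sub>1 * (\<Sum>t=1..T. \<alpha> t) + \<gamma>\<^sub>0 * G\<^sub>2 * (\<Sum>t=1..T. \<Sum>i\<in>UNIV. h i t)"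
    by (simp add: sum.distrib sum_distrib_left mult_ac)
  also have "\<dots> \<le> real CARD('n) * G\<^sub>1 * (real T powr (1 - c) / (1 - c))
      + \<gamma>\<^sub>0 * G\<^sub>2 * (penalty_const * real T powr (1 - c))"
    using G\<^sub>1_pos G\<^sub>2_pos \<gamma>\<^sub>0_pos by (intro add_mono mult_left_mono sum_\<alpha>_le sum_h_le T) auto
  also have "\<dots> = \<sigma> * (movement_const * real T powr (1 - c))"
    using \<sigma>_pos by (simp add: movement_const_def field_simps)
  finally show ?thesis
    using \<sigma>_pos by simp
qed

text \<open>One sequence \<open>d\<close> serves all horizons \<open>T\<close>. The constant initial
  spread is absorbed because \<open>T powr (1 - c)\<close> is at least 1.\<close>

lemma consensus_bound:
  obtains d where "\<And>i j t. 1 \<le> t \<Longrightarrow> norm (x i t - x j t) \<le> d t"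
    and "\<And>T. 1 \<le> T \<Longrightarrow> (\<Sum>t=1..T. d t) \<le> consensus_const * real T powr (1 - c)"
proof -
  let ?D = "sqrt (2 * K / \<sigma>)" and ?L = "CARD('n) * B"
  obtain d where d: "\<And>i j t. 1 \<le> t \<Longrightarrow>
        norm ((\<Sum>k\<in>UNIV. W t $ i $ k *\<^sub>R z k t) - (\<Sum>k\<in>UNIV. W t $ j $ k *\<^sub>R z k t)) \<le> d t"
    and sum_d: "\<And>T. (\<Sum>t=1..T. d t) \<le> real ?L * (?D + 2 * (\<Sum>t=1..T. \<Sum>i\<in>UNIV.
        norm (z i (Suc t) - (\<Sum>k\<in>UNIV. W t $ i $ k *\<^sub>R z k t)))) / (real CARD('n) * w ^ ?L)"
    by (rule sum_consensus_error_le[of z ?D]) (use norm_diff_le z_in weight_bounds in auto)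
  show thesis
  proof (rule that)
    show "norm (x i t - x j t) \<le> d t" if "1 \<le> t" for i j t
      using d[OF that] by (simp add: x_eq[OF that])
    fix T :: nat
    assume T: "1 \<le> T"
    have "(\<Sum>t=1..T. \<Sum>i\<in>UNIV. norm (z i (Suc t) - (\<Sum>k\<in>UNIV. W t $ i $ k *\<^sub>R z k t)))
        = (\<Sum>t=1..T. \<Sum>i\<in>UNIV. e i t)"
      by (simp add: x_eq)
    moreover have "?D \<le> ?D * real T powr (1 - c)"
      using T c_bounds K_pos \<sigma>_pos mult_left_mono[of 1 "real T powr (1 - c)" ?D]
      by (simp add: ge_one_powr_ge_zero)
    ultimately have "?D + 2 * (\<Sum>t=1..T. \<Sum>i\<in>UNIV. norm (z i (Suc t) - (\<Sum>k\<in>UNIV. W t $ i $ k *\<^sub>R z k t)))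
        \<le> (?D + 2 * movement_const) * real T powr (1 - c)"
      using sum_e_le[OF T] by (simp add: algebra_simps)
    then have "real ?L * (?D + 2 * (\<Sum>t=1..T. \<Sum>i\<in>UNIV.
        norm (z i (Suc t) - (\<Sum>k\<in>UNIV. W t $ i $ k *\<^sub>R z k t)))) / (real CARD('n) * w ^ ?L)
      \<le> real ?L * ((?D + 2 * movement_const) * real T powr (1 - c)) / (real CARD('n) * w ^ ?L)"
      using weight_bounds by (intro divide_right_mono mult_left_mono) auto
    with sum_d[of T] show "(\<Sum>t=1..T. d t) \<le> consensus_const * real T powr (1 - c)"
      by (simp add: consensus_const_def)
  qed
qed

text \<open>Each agent is charged only for its own loss at its own iterate. For a feasible
  comparator the penalty term has a favourable sign, and dividing by \<open>\<alpha> t\<close>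
  leaves the nondecreasing weights \<open>t powr c\<close> on the potential differences.\<close>

lemma local_regret_le:
  assumes T: "1 \<le> T" and y: "y \<in> feasible_set X m g T"
  shows "(\<Sum>t=1..T. \<Sum>i\<in>UNIV. loss i t (x i t) - loss i t y)
    \<le> real CARD('n) * (G\<^sub>1\<^sup>2 / (\<sigma> * (1 - c)) * real T powr (1 - c) + K * real T powr c)"
proof -
  define N where "N = real CARD('n)"
  have yX: "y \<in> X" and feas: "\<And>t i k. 1 \<le> t \<Longrightarrow> t \<le> T \<Longrightarrow> k < m i \<Longrightarrow> g i t y k \<le> 0"
    using y by (auto simp: feasible_set_def)
  have step: "(\<Sum>i\<in>UNIV. loss i t (x i t) - loss i t y)
      \<le> N * (G\<^sub>1\<^sup>2 / \<sigma>) * \<alpha> t + real t powr c * (potential y t - potential y (Suc t))"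
    if t: "1 \<le> t" "t \<le> T" for t
  proof -
    have "(\<Sum>i\<in>UNIV. \<Sum>k<m i. max 0 (g i t (x i t) k) * g i t y k) \<le> 0"
      using feas[OF t] by (intro sum_nonpos mult_nonneg_nonpos) auto
    then have "\<gamma>\<^sub>0 * (\<Sum>i\<in>UNIV. \<Sum>k<m i. max 0 (g i t (x i t) k) * g i t y k) \<le> 0"
      using \<gamma>\<^sub>0_pos by (simp add: mult_nonneg_nonpos)
    with network_energy_step[OF t(1) yX]
    have "\<alpha> t * (\<Sum>i\<in>UNIV. loss i t (x i t) - loss i t y)
        \<le> N * ((\<alpha> t)\<^sup>2 * G\<^sub>1\<^sup>2 / \<sigma>) + (potential y t - potential y (Suc t))"
      by (simp add: N_def)
    then have "(\<Sum>i\<in>UNIV. loss i t (x i t) - loss i t y)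
        \<le> (N * ((\<alpha> t)\<^sup>2 * G\<^sub>1\<^sup>2 / \<sigma>) + (potential y t - potential y (Suc t))) / \<alpha> t"
      using \<alpha>_pos[OF t(1)] by (simp add: pos_le_divide_eq mult.commute)
    also have "\<dots> = N * (G\<^sub>1\<^sup>2 / \<sigma>) * \<alpha> t + (potential y t - potential y (Suc t)) / \<alpha> t"
      using \<alpha>_pos[OF t(1)] by (simp add: add_divide_distrib power2_eq_square)
    also have "(potential y t - potential y (Suc t)) / \<alpha> t
        = real t powr c * (potential y t - potential y (Suc t))"
      using t by (simp add: \<alpha>)
    finally show ?thesis .
  qed
  have "(\<Sum>t=1..T. \<Sum>i\<in>UNIV. loss i t (x i t) - loss i t y)
      \<le> (\<Sum>t=1..T. N * (G\<^sub>1\<^sup>2 / \<sigma>) * \<alpha> t + real t powr c * (potential y t - potential y (Suc t)))"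
    by (rule sum_mono) (use step in auto)
  also have "\<dots> = N * (G\<^sub>1\<^sup>2 / \<sigma>) * (\<Sum>t=1..T. \<alpha> t)
      + (\<Sum>t=1..T. real t powr c * (potential y t - potential y (Suc t)))"
    by (simp only: sum.distrib sum_distrib_left)
  also have "\<dots> \<le> N * (G\<^sub>1\<^sup>2 / \<sigma>) * (real T powr (1 - c) / (1 - c)) + real T powr c * (N * K)"
  proof (rule add_mono)
    show "N * (G\<^sub>1\<^sup>2 / \<sigma>) * (\<Sum>t=1..T. \<alpha> t) \<le> N * (G\<^sub>1\<^sup>2 / \<sigma>) * (real T powr (1 - c) / (1 - c))"
      using \<sigma>_pos by (intro mult_left_mono sum_\<alpha>_le) (auto simp: N_def)
    show "(\<Sum>t=1..T. real t powr c * (potential y t - potential y (Suc t))) \<le> real T powr c * (N * K)"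
      using T potential_nonneg[OF _ yX] potential_le[OF _ yX] c_bounds
      by (intro weighted_telescope_le) (auto simp: N_def intro!: powr_mono2)
  qed
  finally show ?thesis
    by (simp add: N_def algebra_simps)
qed

section \<open>From each agent's own iterate to the whole network\<close>

lemma loss_le:
  assumes t: "1 \<le> t" and "y \<in> X"
  shows "loss i t y \<le> loss i t y' + G\<^sub>1 * norm (y - y')"
proof -
  obtain a v where a: "a \<in> subdiff (f i t) y" and v: "v \<in> subdiff (r t) y"
    using subdiff_nonempty(1,2)[OF assms] by blast
  then have "loss i t y \<le> loss i t y' + (a + v) \<bullet> (y - y')"
    by (auto simp: subdiff_def local_loss_def algebra_simps dest!: spec[of _ y'])
  also have "(a + v) \<bullet> (y - y') \<le> norm (a + v) * norm (y - y')"
    by (rule norm_cauchy_schwarz)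
  also have "\<dots> \<le> G\<^sub>1 * norm (y - y')"
    using subgrad_le[OF assms a v] by (simp add: mult_right_mono)
  finally show ?thesis by simp
qed

lemma pos_part_norm_le:
  assumes "1 \<le> t" and "y \<in> X"
  shows "pos_part_norm i t y \<le> pos_part_norm i t y' + G\<^sub>2 * norm (y - y')"
proof -
  obtain M where M: "M \<in> subgrad_matrices (m i) (g i t) y"
    using subdiff_nonempty(3)[OF assms] by blast
  from L2_set_pos_part_le[OF M subgrad_matrix_le[OF assms M]] show ?thesis
    by (simp add: pos_part_norm_def)
qed

text \<open>The norm of the stacked vector is the Euclidean norm of the block norms, hence at most
  their sum.\<close>

lemma violation_le: "violation m g t y \<le> (\<Sum>j\<in>UNIV. pos_part_norm j t y)"
proof -
  have "(violation m g t y)\<^sup>2 = (\<Sum>j\<in>UNIV. (pos_part_norm j t y)\<^sup>2)"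
    by (simp add: violation_def pos_part_norm_def L2_set_def sum_nonneg sum.Sigma split_def)
  then have "sqrt ((violation m g t y)\<^sup>2) = L2_set (\<lambda>j. pos_part_norm j t y) UNIV"
    by (simp only: L2_set_def)
  then have "violation m g t y = L2_set (\<lambda>j. pos_part_norm j t y) UNIV"
    by (simp add: violation_def)
  also have "\<dots> \<le> (\<Sum>j\<in>UNIV. pos_part_norm j t y)"
    by (intro L2_set_le_sum h_nonneg)
  finally show ?thesis .
qed

text \<open>The constraint of agent \<open>j\<close> at the iterate of agent \<open>i\<close> is
  compared with its value at the iterate of \<open>j\<close>; the discrepancy is at most
  \<open>G\<^sub>2\<close> times the consensus error.\<close>

lemma net_violation_le:
  assumes T: "1 \<le> T"
  shows "net_violation m g x T \<le> violation_const * real T powr (1 - c)"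
proof -
  obtain d where d: "\<And>i j t. 1 \<le> t \<Longrightarrow> norm (x i t - x j t) \<le> d t"
    and sum_d: "\<And>T. 1 \<le> T \<Longrightarrow> (\<Sum>t=1..T. d t) \<le> consensus_const * real T powr (1 - c)"
    by (rule consensus_bound) blast
  define N where "N = real CARD('n)"
  have "(\<Sum>t=1..T. violation m g t (x i t))
      \<le> (\<Sum>t=1..T. \<Sum>j\<in>UNIV. h j t + G\<^sub>2 * d t)" for i
  proof (intro sum_mono order_trans[OF violation_le])
    fix j t assume "t \<in> {1..T}"
    then have t: "1 \<le> t" by simp
    have "pos_part_norm j t (x i t) \<le> h j t + G\<^sub>2 * norm (x i t - x j t)"
      by (rule pos_part_norm_le[OF t x_in[OF t]])
    also have "\<dots> \<le> h j t + G\<^sub>2 * d t"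
      using G\<^sub>2_pos d[OF t] by simp
    finally show "pos_part_norm j t (x i t) \<le> h j t + G\<^sub>2 * d t" .
  qed
  moreover have "(\<Sum>t=1..T. \<Sum>j\<in>UNIV. h j t + G\<^sub>2 * d t) \<le> violation_const * real T powr (1 - c)"
  proof -
    have "(\<Sum>t=1..T. \<Sum>j\<in>UNIV. h j t + G\<^sub>2 * d t)
        = (\<Sum>t=1..T. \<Sum>j\<in>UNIV. h j t) + N * G\<^sub>2 * (\<Sum>t=1..T. d t)"
      by (simp add: N_def sum.distrib sum_distrib_left mult.assoc)
    also have "\<dots> \<le> penalty_const * real T powr (1 - c)
        + N * G\<^sub>2 * (consensus_const * real T powr (1 - c))"
      using G\<^sub>2_pos by (intro add_mono mult_left_mono sum_h_le sum_d T) (auto simp: N_def)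
    finally show ?thesis
      by (simp add: violation_const_def N_def algebra_simps)
  qed
  ultimately have "(\<Sum>i\<in>UNIV. \<Sum>t=1..T. violation m g t (x i t)) \<le> N * (violation_const * real T powr (1 - c))"
    using sum_bounded_above[of "UNIV :: 'n set"] unfolding N_def by (meson order_trans)
  then show ?thesis
    by (simp add: net_violation_def N_def field_simps)
qed

lemma net_regret_le:
  assumes T: "1 \<le> T" and ne: "feasible_set X m g T \<noteq> {}"
  shows "net_regret X m f r g x T \<le> regret_const * real T powr max c (1 - c)"
proof -
  obtain d where d: "\<And>i j t. 1 \<le> t \<Longrightarrow> norm (x i t - x j t) \<le> d t"
    and sum_d: "\<And>T. 1 \<le> T \<Longrightarrow> (\<Sum>t=1..T. d t) \<le> consensus_const * real T powr (1 - c)"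
    by (rule consensus_bound) blast
  define N where "N = real CARD('n)"
  have N: "0 < N" by (simp add: N_def)
  define R where "R = regret_const * real T powr max c (1 - c)"
  have "(1 / N) * (\<Sum>i\<in>UNIV. \<Sum>t=1..T. global_loss f r t (x i t)) - R \<le> (\<Sum>t=1..T. global_loss f r t y)"
    if y: "y \<in> feasible_set X m g T" for y
  proof -
    have "(\<Sum>t=1..T. global_loss f r t (x i t)) - (\<Sum>t=1..T. global_loss f r t y)
        \<le> G\<^sub>1\<^sup>2 / (\<sigma> * (1 - c)) * real T powr (1 - c) + K * real T powr c
          + G\<^sub>1 * (consensus_const * real T powr (1 - c))" for i
    proof -
      \<comment> \<open>Multiplying by the number of agents removes the averaging, so each local
        loss can be moved to its own agent's iterate.\<close>
      have "N * ((\<Sum>t=1..T. global_loss f r t (x i t)) - (\<Sum>t=1..T. global_loss f r t y))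
          = (\<Sum>t=1..T. \<Sum>j\<in>UNIV. loss j t (x i t) - loss j t y)"
        using N by (simp add: global_loss_def N_def[symmetric] sum_subtractf right_diff_distrib
            sum_divide_distrib[symmetric])
      also have "\<dots> \<le> (\<Sum>t=1..T. \<Sum>j\<in>UNIV. (loss j t (x j t) - loss j t y) + G\<^sub>1 * d t)"
      proof (intro sum_mono)
        fix j t assume "t \<in> {1..T}"
        then have t: "1 \<le> t" by simp
        have "loss j t (x i t) \<le> loss j t (x j t) + G\<^sub>1 * norm (x i t - x j t)"
          by (rule loss_le[OF t x_in[OF t]])
        also have "\<dots> \<le> loss j t (x j t) + G\<^sub>1 * d t"
          using G\<^sub>1_pos d[OF t] by simp
        finally show "loss j t (x i t) - loss j t y \<le> (loss j t (x j t) - loss j t y) + G\<^sub>1 * d t"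
          by simp
      qed
      also have "\<dots> = (\<Sum>t=1..T. \<Sum>j\<in>UNIV. loss j t (x j t) - loss j t y) + N * G\<^sub>1 * (\<Sum>t=1..T. d t)"
        by (simp add: N_def sum.distrib sum_distrib_left mult.assoc)
      also have "\<dots> \<le> N * (G\<^sub>1\<^sup>2 / (\<sigma> * (1 - c)) * real T powr (1 - c) + K * real T powr c)
          + N * G\<^sub>1 * (consensus_const * real T powr (1 - c))"
        unfolding N_def using G\<^sub>1_pos
        by (intro add_mono mult_left_mono local_regret_le sum_d T y) auto
      finally have "N * ((\<Sum>t=1..T. global_loss f r t (x i t)) - (\<Sum>t=1..T. global_loss f r t y))
          \<le> N * (G\<^sub>1\<^sup>2 / (\<sigma> * (1 - c)) * real T powr (1 - c) + K * real T powr c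
          + G\<^sub>1 * (consensus_const * real T powr (1 - c)))"
        by (simp only: distrib_left mult.assoc)
      then show ?thesis
        using N by simp
    qed
    \<comment> \<open>As \<open>T\<close> is at least 1, both exponents can be raised to their
      maximum.\<close>
    also have "G\<^sub>1\<^sup>2 / (\<sigma> * (1 - c)) * real T powr (1 - c) + K * real T powr c
          + G\<^sub>1 * (consensus_const * real T powr (1 - c))
        \<le> G\<^sub>1\<^sup>2 / (\<sigma> * (1 - c)) * real T powr max c (1 - c) + K * real T powr max c (1 - c)
          + G\<^sub>1 * (consensus_const * real T powr max c (1 - c))"
      using T G\<^sub>1_pos K_pos \<sigma>_pos c_bounds consensus_const_pos
      by (intro add_mono mult_left_mono powr_mono) auto
    also have "\<dots> = R"
      by (simp add: R_def regret_const_def distrib_right mult.assoc)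
    finally have "(\<Sum>i\<in>UNIV. \<Sum>t=1..T. global_loss f r t (x i t))
        \<le> (\<Sum>i\<in>(UNIV :: 'n set). R + (\<Sum>t=1..T. global_loss f r t y))"
      by (intro sum_mono) (simp add: algebra_simps)
    then show ?thesis
      using N by (simp add: N_def[symmetric] field_simps)
  qed
  \<comment> \<open>The bound holds against every feasible \<open>y\<close> and so passes to the
    infimum; \<open>ne\<close> excludes the unspecified infimum of the empty set.\<close>
  then have "(1 / N) * (\<Sum>i\<in>UNIV. \<Sum>t=1..T. global_loss f r t (x i t)) - R
      \<le> (INF y\<in>feasible_set X m g T. \<Sum>t=1..T. global_loss f r t y)"
    by (rule cINF_greatest[OF ne])
  then show ?thesis
    using N by (simp add: net_regret_def R_def N_def[symmetric] sum_subtractf field_simps)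
qed

end

text \<open>The constants are chosen before the problem data, the network and the run are
  quantified, which gives the independence of \<open>T\<close> demanded by the order notation,
  uniformly over all such data.\<close>

theorem theorem2:
  fixes m :: "'n::finite \<Rightarrow> nat"
    and F G\<^sub>1 G\<^sub>2 w \<sigma> K \<epsilon>\<^sub>s c \<gamma>\<^sub>0 :: real
    and B :: nat
    and z\<^sub>1 :: "'n \<Rightarrow> real ^ 'p"
  assumes "F > 0" and "G\<^sub>1 > 0" and "G\<^sub>2 > 0" and "0 < w" and "w < 1" and "B > 0"
    and "\<sigma> > 0" and "K > 0" and "\<epsilon>\<^sub>s > 0"
    and "0 < c" and "c < 1"
    and "0 < \<gamma>\<^sub>0" and "\<gamma>\<^sub>0 \<le> \<sigma> / (4 * G\<^sub>2\<^sup>2)"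
  shows "\<exists>C\<^sub>1>0. \<exists>C\<^sub>2>0.
    \<forall>(X :: (real ^ 'p) set)
     (f :: 'n \<Rightarrow> nat \<Rightarrow> real ^ 'p \<Rightarrow> real)
     (r :: nat \<Rightarrow> real ^ 'p \<Rightarrow> real)
     (g :: 'n \<Rightarrow> nat \<Rightarrow> real ^ 'p \<Rightarrow> nat \<Rightarrow> real)
     (E :: nat \<Rightarrow> ('n \<times> 'n) set)
     (W :: nat \<Rightarrow> real ^ 'n ^ 'n)
     (\<psi> :: real ^ 'p \<Rightarrow> real)
     (\<alpha> :: nat \<Rightarrow> real)
     (\<gamma> :: nat \<Rightarrow> real)
     (z :: 'n \<Rightarrow> nat \<Rightarrow> real ^ 'p)
     (x :: 'n \<Rightarrow> nat \<Rightarrow> real ^ 'p).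
      (\<forall>T\<ge>1. feasible_set X m g T \<noteq> {}) \<longrightarrow>
      (\<forall>t\<ge>1. mixing_matrix (E t) (W t)) \<longrightarrow>
      (\<forall>y\<in>X. \<psi> differentiable (at y)) \<longrightarrow> strongly_convex_on X \<sigma> \<psi> \<longrightarrow>
      closed X \<longrightarrow> convex X \<longrightarrow>
      (\<forall>t\<ge>1. convex_on UNIV (r t)) \<longrightarrow>
      (\<forall>i. \<forall>t\<ge>1. convex_on UNIV (f i t)) \<longrightarrow>
      (\<forall>i. \<forall>t\<ge>1. \<forall>k<m i. convex_on UNIV (\<lambda>y. g i t y k)) \<longrightarrow>
      (\<forall>i. \<forall>t\<ge>1. \<forall>y\<in>X. \<forall>y'\<in>X. \<bar>local_loss f r i t y - local_loss f r i t y'\<bar> \<le> F) \<longrightarrow>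
      (\<forall>t\<ge>1. \<forall>y\<in>X. subdiff (r t) y \<noteq> {}) \<longrightarrow>
      (\<forall>i. \<forall>t\<ge>1. \<forall>y\<in>X. subdiff (f i t) y \<noteq> {}) \<longrightarrow>
      (\<forall>i. \<forall>t\<ge>1. \<forall>y\<in>X. subgrad_matrices (m i) (g i t) y \<noteq> {}) \<longrightarrow>
      (\<forall>i. \<forall>t\<ge>1. \<forall>y\<in>X. \<forall>u\<in>subdiff (f i t) y. \<forall>v\<in>subdiff (r t) y. norm (u + v) \<le> G\<^sub>1) \<longrightarrow>
      (\<forall>i. \<forall>t\<ge>1. \<forall>y\<in>X. \<forall>A\<in>subgrad_matrices (m i) (g i t) y. matrix_norm2 (m i) A \<le> G\<^sub>2) \<longrightarrow>
      (\<forall>t\<ge>1. \<forall>i j. W t $ i $ j > 0 \<longrightarrow> W t $ i $ j \<ge> w) \<longrightarrow>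
      (\<forall>t\<ge>1. doubly_stochastic (W t)) \<longrightarrow>
      (\<forall>t\<ge>1. strongly_connected (\<Union>l<B. E (t + l))) \<longrightarrow>
      (\<forall>y\<in>X. convex_on X (bregman \<psi> y)) \<longrightarrow>
      (\<forall>y\<in>X. \<forall>y'\<in>X. bregman \<psi> y y' \<le> K) \<longrightarrow>
      (\<exists>x\<^sub>s\<in>X. \<forall>t\<ge>1. \<forall>i. \<forall>k<m i. g i t x\<^sub>s k \<le> - \<epsilon>\<^sub>s) \<longrightarrow>
      (\<forall>t\<ge>1. \<alpha> t = 1 / real t powr c) \<longrightarrow>
      (\<forall>t\<ge>1. \<gamma> t = \<gamma>\<^sub>0 / \<alpha> t) \<longrightarrow>
      generated_by_algorithm X \<psi> W m f r g \<alpha> \<gamma> z x \<longrightarrow>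
      (\<forall>i. z i 1 = z\<^sub>1 i) \<longrightarrow>
      (\<forall>T\<ge>1. net_regret X m f r g x T \<le> C\<^sub>1 * real T powr max c (1 - c) \<and>
              net_violation m g x T \<le> C\<^sub>2 * real T powr (1 - c))"
proof -
  interpret rate_constants "CARD('n)" B F G\<^sub>1 G\<^sub>2 w \<sigma> K \<epsilon>\<^sub>s c \<gamma>\<^sub>0
    using assms by unfold_locales auto
  show ?thesis
  proof (rule exI[of _ regret_const], rule conjI[OF regret_const_pos],
      rule exI[of _ violation_const], rule conjI[OF violation_const_pos], intro allI impI, goal_cases)
    case (1 X f r g E W \<psi> \<alpha> \<gamma> z x T)
    obtain x\<^sub>s where x\<^sub>s: "x\<^sub>s \<in> X" "\<forall>t\<ge>1. \<forall>i. \<forall>k<m i. g i t x\<^sub>s k \<le> - \<epsilon>\<^sub>s"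
      using 1(21) by blast
    from 1(24)[unfolded generated_by_algorithm_def]
    have z1: "\<forall>i. z i 1 \<in> X"
      by (rule conjunct1)
    from 1(24)[unfolded generated_by_algorithm_def]
    obtain u A q \<omega> where alg: "\<forall>t\<ge>1. \<forall>i. x i t = (\<Sum>j\<in>UNIV. W t $ i $ j *\<^sub>R z j t) \<and>
        u i t \<in> subdiff (f i t) (x i t) \<and>
        A i t \<in> subgrad_matrices (m i) (g i t) (x i t) \<and>
        (\<forall>k<m i. q i (t + 1) k = \<gamma> t * max 0 (g i t (x i t) k)) \<and>
        \<omega> i (t + 1) = u i t + (\<Sum>k<m i. q i (t + 1) k *\<^sub>R A i t k) \<and>
        is_arg_min (\<lambda>y. \<alpha> t * (y \<bullet> \<omega> i (t + 1)) + \<alpha> t * r t y + bregman \<psi> y (x i t))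
          (\<lambda>y. y \<in> X) (z i (t + 1))"
      by (elim conjE exE)
    \<comment> \<open>The values of \<open>q\<close> are prescribed only for \<open>k < m i\<close>,
      which is all that the sum in \<open>\<omega>\<close> sees.\<close>
    have \<omega>: "\<omega> i (Suc t) = u i t + (\<Sum>k<m i. (\<gamma> t * max 0 (g i t (x i t) k)) *\<^sub>R A i t k)"
      if "1 \<le> t" for i t
    proof -
      have "\<omega> i (t + 1) = u i t + (\<Sum>k<m i. q i (t + 1) k *\<^sub>R A i t k)"
        "\<forall>k<m i. q i (t + 1) k = \<gamma> t * max 0 (g i t (x i t) k)"
        using alg that by blast+
      then show ?thesis by simp
    qed
    interpret mixing_network E W w B
      using 1(2,16,17,18) weight_bounds by unfold_locales blast+
    interpret primal_dual_run E W B F G\<^sub>1 G\<^sub>2 w \<sigma> K \<epsilon>\<^sub>s c \<gamma>\<^sub>0 X m f r g \<psi> \<alpha> \<gamma> z x u A x\<^sub>s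
    proof
      show "is_arg_min (\<lambda>y. \<alpha> t * (y \<bullet> (u i t + (\<Sum>k<m i. (\<gamma> t * max 0 (g i t (x i t) k)) *\<^sub>R A i t k)))
        + \<alpha> t * r t y + bregman \<psi> y (x i t)) (\<lambda>y. y \<in> X) (z i (Suc t))" if "1 \<le> t" for t i
      proof -
        have "is_arg_min (\<lambda>y. \<alpha> t * (y \<bullet> \<omega> i (t + 1)) + \<alpha> t * r t y + bregman \<psi> y (x i t))
            (\<lambda>y. y \<in> X) (z i (t + 1))"
          using alg that by blast
        then show ?thesis
          by (simp add: \<omega>[OF that])
      qed
      show "convex_on X (r t)" if "1 \<le> t" for t
        using 1(6,7) that by (auto intro: convex_on_subset)
      show "x i t = (\<Sum>j\<in>UNIV. W t $ i $ j *\<^sub>R z j t)" "u i t \<in> subdiff (f i t) (x i t)"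
        "A i t \<in> subgrad_matrices (m i) (g i t) (x i t)" if "1 \<le> t" for t i
        using alg that by blast+
      show "\<psi> differentiable at y" if "y \<in> X" for y
        using 1(3) that by blast
      show "\<bar>local_loss f r i t y - local_loss f r i t y'\<bar> \<le> F"
        if "1 \<le> t" "y \<in> X" "y' \<in> X" for t y y' i
        using 1(10) that by blast
      show "subdiff (r t) y \<noteq> {}" "subdiff (f i t) y \<noteq> {}" "subgrad_matrices (m i) (g i t) y \<noteq> {}"
        if "1 \<le> t" "y \<in> X" for t y i
        using 1(11-13) that by blast+
      show "norm (a + v) \<le> G\<^sub>1"
        if "1 \<le> t" "y \<in> X" "a \<in> subdiff (f i t) y" "v \<in> subdiff (r t) y" for t y a i v
        using 1(14) that by blast
      show "matrix_norm2 (m i) M \<le> G\<^sub>2" if "1 \<le> t" "y \<in> X" "M \<in> subgrad_matrices (m i) (g i t) y" for t y M i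
        using 1(15) that by blast
      show "convex_on X (bregman \<psi> y)" if "y \<in> X" for y
        using 1(19) that by blast
      show "bregman \<psi> y y' \<le> K" if "y \<in> X" "y' \<in> X" for y y'
        using 1(20) that by blast
      show "g i t x\<^sub>s k \<le> - \<epsilon>\<^sub>s" if "1 \<le> t" "k < m i" for t k i
        using x\<^sub>s that by blast
      show "\<alpha> t = 1 / real t powr c" "\<gamma> t = \<gamma>\<^sub>0 / \<alpha> t" if "1 \<le> t" for t
        using 1(22,23) that by blast+
      show "z i 1 \<in> X" for i
        using z1 by blast
      show "convex X"
        by (fact 1(6))
      show "strongly_convex_on X \<sigma> \<psi>"
        by (fact 1(4))
      show "x\<^sub>s \<in> X"
        by (fact x\<^sub>s(1))
    qed
    show ?case
      using net_regret_le[OF 1(26) 1(1)[rule_format, OF 1(26)]] net_violation_le[OF 1(26)] by (rule conjI)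
  qed
qed

end
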